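(* For all $\ell\ge 1$ and $b\in\mathbb N$: if $\ell$ is odd then $\boldsymbol{\Sigma}^{\mathrm{LFO}}_\ell[\mathsf{PIC}_b]=\mathbf{m}\boldsymbol{\Sigma}^{\mathrm{FO}}_\ell[\mathsf{PIC}_b]$, and if $\ell$ is even then $\boldsymbol{\Pi}^{\mathrm{LFO}}_\ell[\mathsf{PIC}_b]=\mathbf{m}\boldsymbol{\Pi}^{\mathrm{FO}}_\ell[\mathsf{PIC}_b]$. (On pictures, every level of the local second-order hierarchy ending with a block of existential second-order quantifiers defines the same picture properties as the corresponding level of the monadic second-order hierarchy.)
   Context: Pictures. For $b\in\mathbb N$, a $b$-bit picture of size $(m,n)$ with $m,n\ge 1$ is a map $P:\{1,\dots,m\}\times\{1,\dots,n\}\to\{0,1\}^b$; its elements $(i,j)$ are pixels. $\mathsf{PIC}_b$ is the set of all $b$-bit pictures. A picture is identified with its structural representation: the relational structure with domain the set of pixels, unary relations $U_1,\dots,U_b$ where $U_k$ is the set of pixels whose value has $k$-th bit $1$, and binary relations $R_1=\{((i,j),(i+1,j))\}$ ("vertical successor") and $R_2=\{((i,j),(i,j+1))\}$ ("horizontal successor"). Logic. Formulas are built from atomic formulas $U_k(x)$, $x\,R_i\,y$, $x=y$, $X(x_1,\dots,x_k)$ ($X$ a second-order variable of arity $k$), negation, disjunction, first-order quantification $\exists x$, bounded first-order quantification $\exists y\!\leftrightharpoons\! x\ \psi$ (for $y\neq x$; true iff some element $a$ with $a\,R_i\,x$ or $x\,R_i\,a$ for some $i$ satisfies $\psi$ when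 assigned to $y$), and second-order quantification $\exists X$; $\forall,\wedge,\to$ are abbreviations. $\mathrm{FO}$ is the class of formulas without second-order quantifiers (free second-order variables allowed). $\mathrm{BF}$ is the subclass of $\mathrm{FO}$ using only bounded first-order quantification. $\mathrm{LFO}$ is the class of formulas $\forall x\,\psi$ with $\psi\in\mathrm{BF}$. Second-order hierarchy: $\Sigma^{\mathrm{FO}}_0=\Pi^{\mathrm{FO}}_0=\mathrm{FO}$; $\Sigma^{\mathrm{FO}}_\ell$ consists of formulas $\exists X_1\cdots\exists X_n\,\psi$ with $\psi\in\Pi^{\mathrm{FO}}_{\ell-1}$, and $\Pi^{\mathrm{FO}}_\ell$ of formulas $\forall X_1\cdots\forall X_n\,\psi$ with $\psi\in\Sigma^{\mathrm{FO}}_{\ell-1}$. The local second-order hierarchy $\Sigma^{\mathrm{LFO}}_\ell,\Pi^{\mathrm{LFO}}_\ell$ is defined identically starting from $\Sigma^{\mathrm{LFO}}_0=\Pi^{\mathrm{LFO}}_0=\mathrm{LFO}$. The monadic versions $\mathrm{m}\Sigma^{\mathrm{FO}}_\ell,\mathrm{m}\Pi^{\mathrm{FO}}_\ell$ (and $\mathrm{m}\Sigma^{\mathrm{LFO}}_\ell,\mathrm{m}\Pi^{\mathrm{LFO}}_\ell$) require all second-order quantified variables to be unary. Bold notation ($\boldsymbol{\Sigma}^{\mathrm{LFO}}_\ell$, $\mathbf{m}\boldsymbol{\Sigma}^{\mathrm{FO}}_\ell$, etc.) denotes the class of structure properties definable by a sentence of the corresponding formula class, and for a class $\mathcal C$ of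 properties and a set $B$ of structures, $\mathcal C[B]=\{P\cap B: P\in\mathcal C\}$. *)

theory Defs
  imports Main
begin

text \<open>A picture is a triple (m, n, f); pixel (i,j) with 1 <= i <= m, 1 <= j <= n carries
  the value f i j, a bit vector of length b (bit k is f i j ! (k-1)).  Outside the pixel
  set the value is normalised to the empty list so that a picture is determined by its
  size and pixel values.\<close>

type_synonym pixel = "nat \<times> nat"
type_synonym picture = "nat \<times> nat \<times> (nat \<Rightarrow> nat \<Rightarrow> bool list)"

definition pixels :: "picture \<Rightarrow> pixel set" where
  "pixels p = (case p of (m, n, f) \<Rightarrow> {(i, j). 1 \<le> i \<and> i \<le> m \<and> 1 \<le> j \<and> j \<le> n})"

definition PIC :: "nat \<Rightarrow> picture set" where
  "PIC b = {(m, n, f). 1 \<le> m \<and> 1 \<le> n \<and>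
      (\<forall>i j. (if (i, j) \<in> pixels (m, n, f) then length (f i j) = b else f i j = []))}"

definition Urel :: "picture \<Rightarrow> nat \<Rightarrow> pixel set" where
  "Urel p k = {(i, j). (i, j) \<in> pixels p \<and> 1 \<le> k \<and> k \<le> length ((snd (snd p)) i j)
                  \<and> (snd (snd p)) i j ! (k - 1)}"

text \<open>R_1 vertical successor, R_2 horizontal successor.\<close>
definition Rrel :: "picture \<Rightarrow> nat \<Rightarrow> pixel \<Rightarrow> pixel \<Rightarrow> bool" where
  "Rrel p r a c = (a \<in> pixels p \<and> c \<in> pixels p \<and>
     ((r = 1 \<and> c = (fst a + 1, snd a)) \<or> (r = 2 \<and> c = (fst a, snd a + 1))))"

text \<open>First-order variables are natural numbers; a second-order variable is a name together
  with an arity; the atom SOAt X xs refers to the variable (X, length xs).\<close>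

datatype form =
    UAt nat nat                 (* U_k(x) *)
  | RAt nat nat nat             (* x R_i y *)
  | EqAt nat nat
  | SOAt nat "nat list"
  | Neg form
  | Disj form form
  | Ex1 nat form
  | BEx nat nat form            (* exists y <-> x. phi  (bounded) *)
  | SEx nat nat form            (* exists X (of arity k). phi *)

definition All1 :: "nat \<Rightarrow> form \<Rightarrow> form" where
  "All1 x \<phi> = Neg (Ex1 x (Neg \<phi>))"

definition SAll :: "nat \<Rightarrow> nat \<Rightarrow> form \<Rightarrow> form" where
  "SAll X k \<phi> = Neg (SEx X k (Neg \<phi>))"

fun wf :: "nat \<Rightarrow> form \<Rightarrow> bool" where
  "wf b (UAt k x) = (1 \<le> k \<and> k \<le> b)"
| "wf b (RAt i x y) = (i = 1 \<or> i = 2)"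
| "wf b (EqAt x y) = True"
| "wf b (SOAt X xs) = True"
| "wf b (Neg \<phi>) = wf b \<phi>"
| "wf b (Disj \<phi> \<psi>) = (wf b \<phi> \<and> wf b \<psi>)"
| "wf b (Ex1 x \<phi>) = wf b \<phi>"
| "wf b (BEx y x \<phi>) = (y \<noteq> x \<and> wf b \<phi>)"
| "wf b (SEx X k \<phi>) = wf b \<phi>"

fun fv :: "form \<Rightarrow> nat set" where
  "fv (UAt k x) = {x}"
| "fv (RAt i x y) = {x, y}"
| "fv (EqAt x y) = {x, y}"
| "fv (SOAt X xs) = set xs"
| "fv (Neg \<phi>) = fv \<phi>"
| "fv (Disj \<phi> \<psi>) = fv \<phi> \<union> fv \<psi>"
| "fv (Ex1 x \<phi>) = fv \<phi> - {x}"
| "fv (BEx y x \<phi>) = insert x (fv \<phi> - {y})"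
| "fv (SEx X k \<phi>) = fv \<phi>"

fun fsv :: "form \<Rightarrow> (nat \<times> nat) set" where
  "fsv (UAt k x) = {}"
| "fsv (RAt i x y) = {}"
| "fsv (EqAt x y) = {}"
| "fsv (SOAt X xs) = {(X, length xs)}"
| "fsv (Neg \<phi>) = fsv \<phi>"
| "fsv (Disj \<phi> \<psi>) = fsv \<phi> \<union> fsv \<psi>"
| "fsv (Ex1 x \<phi>) = fsv \<phi>"
| "fsv (BEx y x \<phi>) = fsv \<phi>"
| "fsv (SEx X k \<phi>) = fsv \<phi> - {(X, k)}"

definition sentence :: "form \<Rightarrow> bool" where
  "sentence \<phi> = (fv \<phi> = {} \<and> fsv \<phi> = {})"

definition adjacent :: "picture \<Rightarrow> pixel \<Rightarrow> pixel \<Rightarrow> bool" where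
  "adjacent p a c = (\<exists>i\<in>{1, 2}. Rrel p i a c \<or> Rrel p i c a)"

fun sat :: "picture \<Rightarrow> (nat \<Rightarrow> pixel) \<Rightarrow> (nat \<Rightarrow> nat \<Rightarrow> pixel list set) \<Rightarrow> form \<Rightarrow> bool" where
  "sat p v V (UAt k x) = (v x \<in> Urel p k)"
| "sat p v V (RAt i x y) = Rrel p i (v x) (v y)"
| "sat p v V (EqAt x y) = (v x = v y)"
| "sat p v V (SOAt X xs) = (map v xs \<in> V X (length xs))"
| "sat p v V (Neg \<phi>) = (\<not> sat p v V \<phi>)"
| "sat p v V (Disj \<phi> \<psi>) = (sat p v V \<phi> \<or> sat p v V \<psi>)"
| "sat p v V (Ex1 x \<phi>) = (\<exists>a\<in>pixels p. sat p (v(x := a)) V \<phi>)"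
| "sat p v V (BEx y x \<phi>) = (\<exists>a\<in>pixels p. adjacent p a (v x) \<and> sat p (v(y := a)) V \<phi>)"
| "sat p v V (SEx X k \<phi>) =
     (\<exists>S. S \<subseteq> {as. length as = k \<and> set as \<subseteq> pixels p} \<and>
          sat p v (V(X := (V X)(k := S))) \<phi>)"

definition models :: "picture \<Rightarrow> form \<Rightarrow> bool" where
  "models p \<phi> = sat p (\<lambda>_. (1, 1)) (\<lambda>_ _. {}) \<phi>"

fun noSO :: "form \<Rightarrow> bool" where
  "noSO (SEx X k \<phi>) = False"
| "noSO (Neg \<phi>) = noSO \<phi>"
| "noSO (Disj \<phi> \<psi>) = (noSO \<phi> \<and> noSO \<psi>)"
| "noSO (Ex1 x \<phi>) = noSO \<phi>"
| "noSO (BEx y x \<phi>) = noSO \<phi>"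
| "noSO _ = True"

definition isFO :: "form \<Rightarrow> bool" where
  "isFO \<phi> = noSO \<phi>"

fun isBF :: "form \<Rightarrow> bool" where
  "isBF (SEx X k \<phi>) = False"
| "isBF (Ex1 x \<phi>) = False"
| "isBF (Neg \<phi>) = isBF \<phi>"
| "isBF (Disj \<phi> \<psi>) = (isBF \<phi> \<and> isBF \<psi>)"
| "isBF (BEx y x \<phi>) = isBF \<phi>"
| "isBF _ = True"

definition isLFO :: "form \<Rightarrow> bool" where
  "isLFO \<phi> = (\<exists>x \<psi>. \<phi> = All1 x \<psi> \<and> isBF \<psi>)"

fun hier :: "(form \<Rightarrow> bool) \<Rightarrow> bool \<Rightarrow> bool \<Rightarrow> nat \<Rightarrow> form \<Rightarrow> bool" where
  "hier base mon ex 0 \<phi> = base \<phi>"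
| "hier base mon ex (Suc l) \<phi> =
     (\<exists>qs \<psi>. (mon \<longrightarrow> (\<forall>q\<in>set qs. snd q = 1)) \<and> hier base mon (\<not> ex) l \<psi> \<and>
        \<phi> = foldr (\<lambda>q \<chi>. if ex then SEx (fst q) (snd q) \<chi> else SAll (fst q) (snd q) \<chi>) qs \<psi>)"

definition definable_on_PIC :: "(form \<Rightarrow> bool) \<Rightarrow> nat \<Rightarrow> picture set set" where
  "definable_on_PIC C b = {{p \<in> PIC b. models p \<phi>} | \<phi>. sentence \<phi> \<and> wf b \<phi> \<and> C \<phi>}"

definition SigmaLFO :: "nat \<Rightarrow> nat \<Rightarrow> picture set set" where
  "SigmaLFO l b = definable_on_PIC (hier isLFO False True l) b"
definition PiLFO :: "nat \<Rightarrow> nat \<Rightarrow> picture set set" where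
  "PiLFO l b = definable_on_PIC (hier isLFO False False l) b"
definition mSigmaFO :: "nat \<Rightarrow> nat \<Rightarrow> picture set set" where
  "mSigmaFO l b = definable_on_PIC (hier isFO True True l) b"
definition mPiFO :: "nat \<Rightarrow> nat \<Rightarrow> picture set set" where
  "mPiFO l b = definable_on_PIC (hier isFO True False l) b"

end

(* Idea.  On pictures, a bounded formula around a pixel x can only evaluate a relation variable on
   tuples inside a ball around x.  Such a tuple is determined by its first pixel and finitely many
   possible offsets, so a relation variable is the same as a finite family of unary ones, and
   every LFO level is contained in the corresponding monadic FO level.

   Conversely, by Hanf's argument (windows of the grid play the role of sphere types), an
   FO sentence with unary predicates only depends on the number, up to a threshold, of occurrences
   of each window.  These numbers can be computed by local rules: first prefix counts along each row,
   then sums of the row counts down each column, with the verdict checked at the bottom right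
   corner.  The prefix counts are guessed as unary relations, which is affordable because the last
   second-order block is existential. *)
theory Submission
  imports Defs "HOL-Library.Product_Plus" "HOL-Library.Countable"
begin

section \<open>Windows and the back-and-forth extension\<close>

text \<open>Windows can stand in for sphere types because a picture is a rectangle in the integer
  plane: two neighbourhoods are compared by translation, so equality of functions replaces
  isomorphism, and any two pixels are joined by an L-shaped walk that stays inside the picture. Such
  walks let bounded quantifiers, which move one step at a time, reach every fixed offset. In the
  second direction the obstacle is that no linear order of all pixels is at hand to count along.
  Counting in rows and then in columns needs none: a counter depends only on its own pixel and the
  neighbours to the left or above, and the last pixel is recognised by its missing neighbours. The
  rules have exactly one solution, so the guess is forced, and guessing it is equivalent to the
  matrix for every value of the outer relations. Hence the invariance under equal window counts is
  proved for arbitrary interpretations of the unary variables: the prefix stays, only the innermost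
  block grows. Parity matters in this direction alone; recoding relations by unary ones works for
  both kinds of block.\<close>

type_synonym offset = "int \<times> int"

definition box :: "nat \<Rightarrow> offset set" where
  "box r = {d. \<bar>fst d\<bar> \<le> int r \<and> \<bar>snd d\<bar> \<le> int r}"

lemma finite_box [simp]: "finite (box r)"
proof -
  have "box r \<subseteq> {- int r..int r} \<times> {- int r..int r}"
    by (auto simp: box_def)
  then show ?thesis
    by (rule finite_subset) simp
qed

lemma zero_in_box [simp]: "0 \<in> box r"
  by (simp add: box_def)

lemma box_add: "d \<in> box r \<Longrightarrow> e \<in> box s \<Longrightarrow> d + e \<in> box (r + s)"
  by (auto simp: box_def)

lemma box_diff: "d \<in> box r \<Longrightarrow> e \<in> box s \<Longrightarrow> d - e \<in> box (r + s)"
  by (auto simp: box_def)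

lemma box_uminus_iff [simp]: "- d \<in> box r \<longleftrightarrow> d \<in> box r"
  by (auto simp: box_def)

lemma box_mono: "d \<in> box r \<Longrightarrow> r \<le> s \<Longrightarrow> d \<in> box s"
  by (auto simp: box_def)

text \<open>Inside the box, \<open>None\<close> records a point beyond the border, so border and
  interior differ. Outside the box every entry is \<open>None\<close>, so windows of one radius can
  be compared as functions.\<close>

definition window :: "offset set \<Rightarrow> (offset \<Rightarrow> 'l) \<Rightarrow> nat \<Rightarrow> offset \<Rightarrow> offset \<Rightarrow> 'l option" where
  "window P l r a = (\<lambda>d. if d \<in> box r \<and> a + d \<in> P then Some (l (a + d)) else None)"

lemma window_shift:
  assumes "window P l s a = window P' l' s a'" "d \<in> box t" "r + t \<le> s"
  shows "window P l r (a + d) = window P' l' r (a' + d)"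
proof
  fix e
  show "window P l r (a + d) e = window P' l' r (a' + d) e"
  proof (cases "e \<in> box r")
    case True
    with assms have "d + e \<in> box s"
      by (metis add.commute box_add box_mono)
    with True fun_cong[OF assms(1), of "d + e"] show ?thesis
      by (simp add: window_def add.assoc split: if_splits)
  qed (simp add: window_def)
qed

lemma window_eq_memD:
  assumes "window P l s a = window P' l' s a'" "d \<in> box s"
  shows "a + d \<in> P \<longleftrightarrow> a' + d \<in> P'"
  using fun_cong[OF assms(1), of d] assms(2) by (simp add: window_def split: if_splits)

text \<open>Windows describe each point by itself; the second clause ties together points that are
  close. Points further apart than \<open>r\<close> only have to be so on both sides.\<close>

definition same_local ::
    "nat \<Rightarrow> 'v set \<Rightarrow> offset set \<Rightarrow> (offset \<Rightarrow> 'l) \<Rightarrow> ('v \<Rightarrow> offset)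
      \<Rightarrow> offset set \<Rightarrow> (offset \<Rightarrow> 'l) \<Rightarrow> ('v \<Rightarrow> offset) \<Rightarrow> bool" where
  "same_local r F P l v P' l' v' \<longleftrightarrow>
     (\<forall>x\<in>F. window P l r (v x) = window P' l' r (v' x)) \<and>
     (\<forall>x\<in>F. \<forall>y\<in>F. \<forall>d\<in>box r. v y = v x + d \<longleftrightarrow> v' y = v' x + d)"

text \<open>Including all radii up to \<open>R\<close> makes lowering the radius immediate;
  otherwise counts of small windows would have to be summed from counts of large ones.\<close>

definition same_counts ::
    "nat \<Rightarrow> nat \<Rightarrow> offset set \<Rightarrow> (offset \<Rightarrow> 'l) \<Rightarrow> offset set \<Rightarrow> (offset \<Rightarrow> 'l) \<Rightarrow> bool" where
  "same_counts R T P l P' l' \<longleftrightarrow>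
     (\<forall>r\<le>R. \<forall>w. min T (card {a \<in> P. window P l r a = w}) = min T (card {a \<in> P'. window P' l' r a = w}))"

lemma same_local_sym:
  "same_local r F P l v P' l' v' \<Longrightarrow> same_local r F P' l' v' P l v"
  by (auto simp: same_local_def)

lemma same_counts_sym:
  "same_counts r T P l P' l' \<Longrightarrow> same_counts r T P' l' P l"
  by (auto simp: same_counts_def)

lemma same_local_mono:
  assumes "same_local s F P l v P' l' v'" "r \<le> s" "G \<subseteq> F"
  shows "same_local r G P l v P' l' v'"
proof -
  have "window P l r (v x) = window P' l' r (v' x)" if "x \<in> G" for x
  proof -
    have "window P l s (v x) = window P' l' s (v' x)"
      using assms that by (auto simp: same_local_def)
    from window_shift[OF this, of 0 0 r] assms(2) show ?thesis by simp
  qed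
  moreover have "v y = v x + d \<longleftrightarrow> v' y = v' x + d" if "x \<in> G" "y \<in> G" "d \<in> box r" for x y d
    using assms(1,3) that(1,2) box_mono[OF that(3) assms(2)] unfolding same_local_def by (meson subsetD)
  ultimately show ?thesis by (simp add: same_local_def)
qed

lemma same_counts_mono:
  assumes "same_counts s T' P l P' l'" "r \<le> s" "T \<le> T'"
  shows "same_counts r T P l P' l'"
  unfolding same_counts_def
proof (intro allI impI)
  fix q w assume "q \<le> r"
  with assms have "min T' (card {a \<in> P. window P l q a = w}) = min T' (card {a \<in> P'. window P' l' q a = w})"
    by (auto simp: same_counts_def)
  with assms(3) show "min T (card {a \<in> P. window P l q a = w}) = min T (card {a \<in> P'. window P' l' q a = w})"
    by linarith
qed

text \<open>Both maps identify the same indices, so \<open>g i\<close> can be sent to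
  \<open>h i\<close>. This is needed because one point may be reached from several tuple entries by
  different offsets, so addresses cannot be counted in place of points.\<close>

lemma card_image_eq_if_same_kernel:
  assumes "\<And>i j. i \<in> I \<Longrightarrow> j \<in> I \<Longrightarrow> g i = g j \<longleftrightarrow> h i = h j"
  shows "card (g ` I) = card (h ` I)"
proof (rule bij_betw_same_card)
  let ?f = "\<lambda>x. h (inv_into I g x)"
  have f: "?f (g i) = h i" if "i \<in> I" for i
    using that assms by (metis f_inv_into_f imageI inv_into_into)
  show "bij_betw ?f (g ` I) (h ` I)"
    unfolding bij_betw_def by (auto simp: inj_on_def f assms image_image)
qed

text \<open>A point close to the tuple is matched by the same offset. A far point is matched by counting:
  the points of its window type that are close to the tuple are equally many on both sides,
  and fewer than the threshold.\<close>

lemma same_local_extend: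
  fixes v :: "'v \<Rightarrow> offset"
  assumes fin: "finite P" "finite P'" "finite F"
    and loc: "same_local (4 * r) F P l v P' l' v'"
    and cnt: "same_counts R T P l P' l'" and "r \<le> R"
    and T: "card (F \<times> box (2 * r)) < T"
    and "a \<in> P" "x \<notin> F"
  shows "\<exists>a'\<in>P'. same_local r (insert x F) P l (v(x := a)) P' l' (v'(x := a'))"
proof -
  have win: "window P l (4 * r) (v y) = window P' l' (4 * r) (v' y)" if "y \<in> F" for y
    using loc that by (auto simp: same_local_def)
  have off: "v z = v y + d \<longleftrightarrow> v' z = v' y + d" if "y \<in> F" "z \<in> F" "d \<in> box (4 * r)" for y z d
    using loc that by (auto simp: same_local_def)
  have loc_r: "same_local r F P l v P' l' v'"
    using same_local_mono[OF loc] by simp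
  have ext: ?thesis if a': "a' \<in> P'" "window P l r a = window P' l' r a'"
      "\<And>y d. y \<in> F \<Longrightarrow> d \<in> box r \<Longrightarrow> a = v y + d \<longleftrightarrow> a' = v' y + d" for a'
  proof (rule bexI[OF _ a'(1)])
    have 1: "v y = a + d \<longleftrightarrow> v' y = a' + d" if "y \<in> F" "d \<in> box r" for y d
      using a'(3)[of y "- d"] that by (auto simp: algebra_simps)
    have ne: "y \<noteq> x" if "y \<in> F" for y using that \<open>x \<notin> F\<close> by auto
    show "same_local r (insert x F) P l (v(x := a)) P' l' (v'(x := a'))"
      using loc_r a'(2,3) 1 ne unfolding same_local_def by auto
  qed
  show ?thesis
  proof (cases "\<exists>y\<in>F. \<exists>d\<in>box (2 * r). a = v y + d")
    case True
    then obtain y d where yd: "y \<in> F" "d \<in> box (2 * r)" "a = v y + d" by auto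
    have d4: "d \<in> box (4 * r)" using yd(2) by (rule box_mono) simp
    show ?thesis
    proof (rule ext[of "v' y + d"])
      show "v' y + d \<in> P'"
        using window_eq_memD[OF win[OF yd(1)] d4] \<open>a \<in> P\<close> yd(3) by simp
      show "window P l r a = window P' l' r (v' y + d)"
        unfolding yd(3) by (rule window_shift[OF win[OF yd(1)] yd(2)]) simp
      show "a = v z + e \<longleftrightarrow> v' y + d = v' z + e" if "z \<in> F" "e \<in> box r" for z e
      proof -
        \<comment> \<open>The new point lies within \<open>2 * r\<close> of \<open>v y\<close>, so
          closeness to another entry \<open>v z\<close> becomes a statement about the offset between
          two old entries, which radius \<open>4 * r\<close> controls.\<close>
        have "d - e \<in> box (4 * r)"
          using box_diff[OF yd(2) that(2)] by (rule box_mono) simp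
        from off[OF yd(1) that(1) this] show ?thesis
          unfolding yd(3) by (auto simp: algebra_simps)
      qed
    qed
  next
    case False
    define w where "w = window P l r a"
    \<comment> \<open>The addresses, relative to the tuple, of close points having the same window
      as \<open>a\<close>. By \<open>I'\<close> the same addresses serve on the other side.\<close>
    define I where "I = {(y, d) \<in> F \<times> box (2 * r). v y + d \<in> P \<and> window P l r (v y + d) = w}"
    define g where "g = (\<lambda>(y, d). v y + d)"
    define g' where "g' = (\<lambda>(y, d). v' y + d)"
    have I': "I = {(y, d) \<in> F \<times> box (2 * r). v' y + d \<in> P' \<and> window P' l' r (v' y + d) = w}"
    proof -
      have "v y + d \<in> P \<longleftrightarrow> v' y + d \<in> P'" "window P l r (v y + d) = window P' l' r (v' y + d)"
        if "y \<in> F" "d \<in> box (2 * r)" for y d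
        using window_eq_memD[OF win[OF that(1)] box_mono[OF that(2)]]
          window_shift[OF win[OF that(1)] that(2), of r] by auto
      then show ?thesis unfolding I_def by auto
    qed
    have kernel: "g i = g j \<longleftrightarrow> g' i = g' j" if ij: "i \<in> I" "j \<in> I" for i j
    proof -
      obtain y d z e where [simp]: "i = (y, d)" "j = (z, e)" by (metis surj_pair)
      have yz: "y \<in> F" "z \<in> F" "d \<in> box (2 * r)" "e \<in> box (2 * r)"
        using ij by (simp_all add: I_def)
      have "d - e \<in> box (4 * r)"
        using box_diff[OF yz(3,4)] by (rule box_mono) simp
      from off[OF yz(1,2) this] have "v z = v y + (d - e) \<longleftrightarrow> v' z = v' y + (d - e)" .
      moreover have "v y + d = v z + e \<longleftrightarrow> v z = v y + (d - e)" "v' y + d = v' z + e \<longleftrightarrow> v' z = v' y + (d - e)"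
        by (auto simp: algebra_simps)
      ultimately show ?thesis
        by (simp add: g_def g'_def)
    qed
    have "I \<subseteq> F \<times> box (2 * r)" by (auto simp: I_def)
    moreover have "finite (F \<times> box (2 * r))"
      using fin(3) by simp
    ultimately have finI: "finite I" and cI: "card I < T"
      using T card_mono[of "F \<times> box (2 * r)" I] finite_subset by auto
    have "card (g ` I) = card (g' ` I)"
      by (rule card_image_eq_if_same_kernel) (rule kernel)
    moreover have "card (g ` I) < card {c \<in> P. window P l r c = w}"
    proof (rule psubset_card_mono)
      show "g ` I \<subset> {c \<in> P. window P l r c = w}"
      proof
        show "g ` I \<subseteq> {c \<in> P. window P l r c = w}"
          by (auto simp: I_def g_def)
        \<comment> \<open>The far point \<open>a\<close> has window \<open>w\<close> but no address,
          so the addressed points are a proper subset.\<close>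
        have "a \<notin> g ` I"
          using False by (auto simp: I_def g_def)
        then show "g ` I \<noteq> {c \<in> P. window P l r c = w}"
          using \<open>a \<in> P\<close> w_def by blast
      qed
    qed (use fin in simp)
    moreover have "min T (card {c \<in> P. window P l r c = w}) = min T (card {c \<in> P'. window P' l' r c = w})"
      using cnt \<open>r \<le> R\<close> by (auto simp: same_counts_def)
    moreover have "card (g' ` I) < T"
      using card_image_le[OF finI, of g'] cI by simp
    \<comment> \<open>If the addressed points were all points of this type in \<open>P'\<close>,
      their number would be below \<open>T\<close>, where truncated counts are exact; then
      \<open>P\<close> would have equally many, contradicting the strict inclusion.\<close>
    ultimately have "g' ` I \<noteq> {c \<in> P'. window P' l' r c = w}"
      by auto
    moreover have "g' ` I \<subseteq> {c \<in> P'. window P' l' r c = w}"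
      by (auto simp: I' g'_def)
    ultimately obtain a' where a': "a' \<in> P'" "window P' l' r a' = w" "a' \<notin> g' ` I"
      by blast
    show ?thesis
    proof (rule ext[OF a'(1)])
      show "window P l r a = window P' l' r a'"
        using a' w_def by simp
      show "a = v y + d \<longleftrightarrow> a' = v' y + d" if "y \<in> F" "d \<in> box r" for y d
      proof -
        have "d \<in> box (2 * r)" using that(2) by (rule box_mono) simp
        moreover have "a' \<noteq> v' y + d"
        proof
          assume "a' = v' y + d"
          with a'(1,2) that(1) \<open>d \<in> box (2 * r)\<close> have "(y, d) \<in> I" by (auto simp: I')
          with a'(3) \<open>a' = v' y + d\<close> show False by (auto simp: g'_def)
        qed
        ultimately show ?thesis using False that(1) by blast
      qed
    qed
  qed
qed

section \<open>First-order logic on pictures only counts windows\<close>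

definition pos :: "pixel \<Rightarrow> offset" where
  "pos a = (int (fst a), int (snd a))"

definition unpos :: "offset \<Rightarrow> pixel" where
  "unpos d = (nat (fst d), nat (snd d))"

lemma unpos_pos [simp]: "unpos (pos a) = a"
  by (simp add: pos_def unpos_def)

lemma pos_eq_iff [simp]: "pos a = pos c \<longleftrightarrow> a = c"
  by (metis unpos_pos)

definition grid :: "picture \<Rightarrow> offset set" where
  "grid p = pos ` pixels p"

lemma pos_in_grid_iff [simp]: "pos a \<in> grid p \<longleftrightarrow> a \<in> pixels p"
  by (auto simp: grid_def)

lemma unpos_in_pixels: "u \<in> grid p \<Longrightarrow> unpos u \<in> pixels p"
  by (auto simp: grid_def)

lemma pos_unpos: "u \<in> grid p \<Longrightarrow> pos (unpos u) = u"
  by (auto simp: grid_def)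

lemma grid_eq: "grid (m, n, f) = {1..int m} \<times> {1..int n}"
proof -
  have "(i, j) \<in> pos ` pixels (m, n, f)" if "1 \<le> i" "i \<le> int m" "1 \<le> j" "j \<le> int n" for i j
    using that by (intro image_eqI[of _ _ "(nat i, nat j)"]) (auto simp: pos_def pixels_def)
  then show ?thesis
    by (auto simp: grid_def pos_def pixels_def)
qed

lemma finite_grid [simp]: "finite (grid p)"
  by (cases p) (simp add: grid_eq)

text \<open>If the two legs never pull in opposite directions, the intermediate point lies
  coordinatewise between the endpoints, and a rectangle is convex in this sense.\<close>

lemma grid_monotone_path:
  assumes "u \<in> grid p" "u + (e + d) \<in> grid p"
    and "0 \<le> fst e \<and> 0 \<le> fst d \<or> fst e \<le> 0 \<and> fst d \<le> 0"
    and "0 \<le> snd e \<and> 0 \<le> snd d \<or> snd e \<le> 0 \<and> snd d \<le> 0"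
  shows "u + e \<in> grid p"
  using assms by (cases p) (auto simp: grid_eq mem_Times_iff)

lemma pos_eq_add_iff:
  "pos c = pos a + (1, 0) \<longleftrightarrow> c = (fst a + 1, snd a)"
  "pos c = pos a + (0, 1) \<longleftrightarrow> c = (fst a, snd a + 1)"
  by (auto simp: pos_def prod_eq_iff)

lemma Rrel_iff_pos:
  assumes "a \<in> pixels p" "c \<in> pixels p"
  shows "Rrel p 1 a c \<longleftrightarrow> pos c = pos a + (1, 0)" "Rrel p 2 a c \<longleftrightarrow> pos c = pos a + (0, 1)"
  unfolding pos_eq_add_iff using assms by (auto simp: Rrel_def)

definition unit_offsets :: "offset set" where
  "unit_offsets = {(1, 0), (0, 1), (-1, 0), (0, -1)}"

lemma unit_offset_in_box: "e \<in> unit_offsets \<Longrightarrow> e \<in> box (Suc r)"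
  by (auto simp: unit_offsets_def box_def)

lemma adjacent_iff_pos:
  assumes "a \<in> pixels p" "c \<in> pixels p"
  shows "adjacent p a c \<longleftrightarrow> (\<exists>e\<in>unit_offsets. pos a = pos c + e)"
proof -
  have "adjacent p a c \<longleftrightarrow> Rrel p 1 a c \<or> Rrel p 1 c a \<or> Rrel p 2 a c \<or> Rrel p 2 c a"
    by (auto simp: adjacent_def)
  also have "\<dots> \<longleftrightarrow> (\<exists>e\<in>unit_offsets. pos a = pos c + e)"
    unfolding Rrel_iff_pos[OF assms] Rrel_iff_pos[OF assms(2,1)]
    by (auto simp: unit_offsets_def pos_def prod_eq_iff)
  finally show ?thesis .
qed

text \<open>Cutting down to bits up to \<open>b\<close> and names in \<open>\<X>\<close> leaves
  finitely many labels when \<open>\<X>\<close> is finite, hence finitely many windows of each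
  radius.\<close>

definition label :: "nat \<Rightarrow> nat set \<Rightarrow> picture \<Rightarrow> (nat \<Rightarrow> nat \<Rightarrow> pixel list set) \<Rightarrow> offset \<Rightarrow> nat set \<times> nat set"
  where "label b \<X> p V u = ({k \<in> {1..b}. unpos u \<in> Urel p k}, {X \<in> \<X>. [unpos u] \<in> V X 1})"

section \<open>An Ehrenfeucht-Fraisse game on labelled pictures\<close>

definition similar where
  "similar b \<X> r T F p V v p' V' v' \<longleftrightarrow>
     (\<forall>x\<in>F. v x \<in> pixels p \<and> v' x \<in> pixels p') \<and>
     same_counts r T (grid p) (label b \<X> p V) (grid p') (label b \<X> p' V') \<and>
     same_local r F (grid p) (label b \<X> p V) (pos \<circ> v) (grid p') (label b \<X> p' V') (pos \<circ> v')"

lemma similar_sym: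
  "similar b \<X> r T F p V v p' V' v' \<Longrightarrow> similar b \<X> r T F p' V' v' p V v"
  by (auto simp: similar_def intro: same_counts_sym same_local_sym)

lemma similar_mono:
  "similar b \<X> s S G p V v p' V' v' \<Longrightarrow> r \<le> s \<Longrightarrow> T \<le> S \<Longrightarrow> F \<subseteq> G \<Longrightarrow> similar b \<X> r T F p V v p' V' v'"
  by (auto simp: similar_def intro: same_counts_mono same_local_mono)

lemma similar_offset:
  assumes "similar b \<X> r T F p V v p' V' v'" "x \<in> F" "y \<in> F" "d \<in> box r"
  shows "pos (v y) = pos (v x) + d \<longleftrightarrow> pos (v' y) = pos (v' x) + d"
  using assms by (auto simp: similar_def same_local_def)

lemma similar_label:
  assumes "similar b \<X> r T F p V v p' V' v'" "x \<in> F"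
  shows "label b \<X> p V (pos (v x)) = label b \<X> p' V' (pos (v' x))"
proof -
  have "window (grid p) (label b \<X> p V) r (pos (v x)) = window (grid p') (label b \<X> p' V') r (pos (v' x))"
    using assms by (auto simp: similar_def same_local_def)
  from fun_cong[OF this, of 0] show ?thesis
    using assms by (auto simp: window_def similar_def)
qed

text \<open>One round of the game. The starting radius and threshold are chosen before the pictures,
  which is what makes the bounds of the whole induction uniform.\<close>

lemma similar_extend:
  assumes "finite F"
  shows "\<exists>s S. \<forall>p V v p' V' v'. similar b \<X> s S F p V v p' V' v' \<longrightarrow>
    (\<forall>a\<in>pixels p. \<exists>a'\<in>pixels p'. similar b \<X> r T (insert x F) p V (v(x := a)) p' V' (v'(x := a')))"
proof (intro exI allI impI ballI)
  \<comment> \<open>The old value of \<open>x\<close> is about to be overwritten and must not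
    constrain the answer, hence \<open>F - {x}\<close>. The \<open>Suc\<close> makes the bound on
    close points strict.\<close>
  let ?s = "4 * r" and ?S = "max T (Suc (card ((F - {x}) \<times> box (2 * r))))"
  fix p V v p' V' v' a
  assume sim: "similar b \<X> ?s ?S F p V v p' V' v'" and a: "a \<in> pixels p"
  have "\<exists>a'\<in>grid p'. same_local r (insert x (F - {x})) (grid p) (label b \<X> p V) ((pos \<circ> v)(x := pos a))
      (grid p') (label b \<X> p' V') ((pos \<circ> v')(x := a'))"
  proof (rule same_local_extend)
    have "similar b \<X> ?s ?S (F - {x}) p V v p' V' v'"
      using sim by (rule similar_mono) auto
    then show "same_local (4 * r) (F - {x}) (grid p) (label b \<X> p V) (pos \<circ> v)
        (grid p') (label b \<X> p' V') (pos \<circ> v')"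
      "same_counts (4 * r) ?S (grid p) (label b \<X> p V) (grid p') (label b \<X> p' V')"
      by (auto simp: similar_def)
  qed (use assms a in auto)
  then obtain a' where a': "a' \<in> pixels p'"
    "same_local r (insert x F) (grid p) (label b \<X> p V) ((pos \<circ> v)(x := pos a))
      (grid p') (label b \<X> p' V') ((pos \<circ> v')(x := pos a'))"
    by (auto simp: grid_def)
  have upd: "(pos \<circ> u)(x := pos c) = pos \<circ> u(x := c)" for u :: "'a \<Rightarrow> pixel" and c
    by auto
  show "\<exists>a'\<in>pixels p'. similar b \<X> r T (insert x F) p V (v(x := a)) p' V' (v'(x := a'))"
  proof (rule bexI[OF _ a'(1)])
    have "same_counts r T (grid p) (label b \<X> p V) (grid p') (label b \<X> p' V')"
      by (rule same_counts_mono[of ?s ?S]) (use sim in \<open>auto simp: similar_def\<close>)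
    moreover have "same_local r (insert x F) (grid p) (label b \<X> p V) (pos \<circ> v(x := a))
      (grid p') (label b \<X> p' V') (pos \<circ> v'(x := a'))"
      using a'(2) unfolding upd .
    moreover have "(\<forall>y\<in>insert x F. (v(x := a)) y \<in> pixels p \<and> (v'(x := a')) y \<in> pixels p')"
      using sim a a'(1) by (auto simp: similar_def)
    ultimately show "similar b \<X> r T (insert x F) p V (v(x := a)) p' V' (v'(x := a'))"
      unfolding similar_def by blast
  qed
qed

lemma similar_extend_both:
  assumes "finite F"
  obtains s S where
    "\<And>p V v p' V' v' a. similar b \<X> s S F p V v p' V' v' \<Longrightarrow> a \<in> pixels p \<Longrightarrow>
       \<exists>a'\<in>pixels p'. similar b \<X> r T (insert x F) p V (v(x := a)) p' V' (v'(x := a'))"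
    "\<And>p V v p' V' v' a'. similar b \<X> s S F p V v p' V' v' \<Longrightarrow> a' \<in> pixels p' \<Longrightarrow>
       \<exists>a\<in>pixels p. similar b \<X> r T (insert x F) p V (v(x := a)) p' V' (v'(x := a'))"
proof -
  from similar_extend[OF assms, of b \<X> r T x] obtain s S where *:
    "\<forall>p V v p' V' v'. similar b \<X> s S F p V v p' V' v' \<longrightarrow>
    (\<forall>a\<in>pixels p. \<exists>a'\<in>pixels p'. similar b \<X> r T (insert x F) p V (v(x := a)) p' V' (v'(x := a')))"
    by blast
  show thesis
  proof (rule that)
    show "\<exists>a'\<in>pixels p'. similar b \<X> r T (insert x F) p V (v(x := a)) p' V' (v'(x := a'))"
      if "similar b \<X> s S F p V v p' V' v'" "a \<in> pixels p" for p V v p' V' v' a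
      using * that by blast
    show "\<exists>a\<in>pixels p. similar b \<X> r T (insert x F) p V (v(x := a)) p' V' (v'(x := a'))"
      if "similar b \<X> s S F p V v p' V' v'" "a' \<in> pixels p'" for p V v p' V' v' a'
      using * similar_sym[OF that(1)] that(2) by (blast intro: similar_sym)
  qed
qed

text \<open>Induction on the formula, with one round of the game per quantifier. \<open>F\<close>
  may exceed the free variables, so that both parts of a disjunction share it and a quantifier can
  enlarge it.\<close>

lemma FO_invariant_under_similar:
  assumes "isFO \<phi>" "wf b \<phi>" "fsv \<phi> \<subseteq> \<X> \<times> {1}" "finite F" "fv \<phi> \<subseteq> F"
  shows "\<exists>r T. \<forall>p V v p' V' v'. similar b \<X> r T F p V v p' V' v' \<longrightarrow> sat p v V \<phi> = sat p' v' V' \<phi>"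
  using assms unfolding isFO_def
proof (induction \<phi> arbitrary: F)
  case (UAt k x)
  have "sat p v V (UAt k x) = sat p' v' V' (UAt k x)" if "similar b \<X> 0 0 F p V v p' V' v'" for p V v p' V' v'
    using similar_label[OF that, of x] UAt by (auto simp: label_def set_eq_iff)
  then show ?case by blast
next
  case (RAt i x y)
  have "sat p v V (RAt i x y) = sat p' v' V' (RAt i x y)" if "similar b \<X> 1 0 F p V v p' V' v'" for p V v p' V' v'
  proof -
    have "(1, 0) \<in> box 1" "(0, 1) \<in> box 1" by (auto simp: box_def)
    note off = similar_offset[OF that, of x y, OF _ _ this(1)] similar_offset[OF that, of x y, OF _ _ this(2)]
    have "v x \<in> pixels p" "v y \<in> pixels p" "v' x \<in> pixels p'" "v' y \<in> pixels p'"
      using that RAt by (auto simp: similar_def)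
    with off RAt show ?thesis by (auto simp: Rrel_iff_pos[unfolded One_nat_def])
  qed
  then show ?case by blast
next
  case (EqAt x y)
  have "sat p v V (EqAt x y) = sat p' v' V' (EqAt x y)" if "similar b \<X> 0 0 F p V v p' V' v'" for p V v p' V' v'
    using similar_offset[OF that, of x y 0] EqAt by auto
  then show ?case by blast
next
  case (SOAt X xs)
  then obtain x where xs: "xs = [x]" "X \<in> \<X>" by (auto simp: length_Suc_conv)
  have "sat p v V (SOAt X xs) = sat p' v' V' (SOAt X xs)" if "similar b \<X> 0 0 F p V v p' V' v'" for p V v p' V' v'
    using similar_label[OF that, of x] SOAt xs by (auto simp: label_def set_eq_iff)
  then show ?case by blast
next
  case (Neg \<phi>)
  then show ?case by simp
next
  case (Disj \<phi> \<psi>)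
  from Disj.prems Disj.IH(1)[of F] obtain r T where 1:
    "\<forall>p V v p' V' v'. similar b \<X> r T F p V v p' V' v' \<longrightarrow> sat p v V \<phi> = sat p' v' V' \<phi>" by auto
  from Disj.prems Disj.IH(2)[of F] obtain s S where 2:
    "\<forall>p V v p' V' v'. similar b \<X> s S F p V v p' V' v' \<longrightarrow> sat p v V \<psi> = sat p' v' V' \<psi>" by auto
  have "sat p v V (Disj \<phi> \<psi>) = sat p' v' V' (Disj \<phi> \<psi>)"
    if "similar b \<X> (max r s) (max T S) F p V v p' V' v'" for p V v p' V' v'
  proof -
    have "similar b \<X> r T F p V v p' V' v'" "similar b \<X> s S F p V v p' V' v'"
      by (rule similar_mono[OF that]; simp)+
    with 1 2 show ?thesis unfolding sat.simps by metis
  qed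
  then show ?case by blast
next
  case (Ex1 x \<phi>)
  have "fv \<phi> \<subseteq> insert x F" using Ex1.prems by auto
  then obtain r T where 1:
    "\<And>p V v p' V' v'. similar b \<X> r T (insert x F) p V v p' V' v' \<Longrightarrow> sat p v V \<phi> = sat p' v' V' \<phi>"
    using Ex1.IH[of "insert x F"] Ex1.prems by auto
  from similar_extend_both[OF \<open>finite F\<close>, of b \<X> r T x] obtain s S where 2:
    "\<And>p V v p' V' v' a. similar b \<X> s S F p V v p' V' v' \<Longrightarrow> a \<in> pixels p \<Longrightarrow>
       \<exists>a'\<in>pixels p'. similar b \<X> r T (insert x F) p V (v(x := a)) p' V' (v'(x := a'))"
    "\<And>p V v p' V' v' a'. similar b \<X> s S F p V v p' V' v' \<Longrightarrow> a' \<in> pixels p' \<Longrightarrow>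
       \<exists>a\<in>pixels p. similar b \<X> r T (insert x F) p V (v(x := a)) p' V' (v'(x := a'))"
    by blast
  have "sat p v V (Ex1 x \<phi>) = sat p' v' V' (Ex1 x \<phi>)"
    if sim: "similar b \<X> s S F p V v p' V' v'" for p V v p' V' v'
    unfolding sat.simps using 2(1)[OF sim] 2(2)[OF sim] 1 by meson
  then show ?case by blast
next
  case (BEx y x \<phi>)
  have "fv \<phi> \<subseteq> insert y F" using BEx.prems by auto
  then obtain r T where 1:
    "\<And>p V v p' V' v'. similar b \<X> r T (insert y F) p V v p' V' v' \<Longrightarrow> sat p v V \<phi> = sat p' v' V' \<phi>"
    using BEx.IH[of "insert y F"] BEx.prems by auto
  \<comment> \<open>The induction hypothesis may give \<open>r = 0\<close>; \<open>Suc r\<close>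
    guarantees a radius at which adjacency is preserved too.\<close>
  from similar_extend_both[OF \<open>finite F\<close>, of b \<X> "Suc r" T y] obtain s S where 2:
    "\<And>p V v p' V' v' a. similar b \<X> s S F p V v p' V' v' \<Longrightarrow> a \<in> pixels p \<Longrightarrow>
       \<exists>a'\<in>pixels p'. similar b \<X> (Suc r) T (insert y F) p V (v(y := a)) p' V' (v'(y := a'))"
    "\<And>p V v p' V' v' a'. similar b \<X> s S F p V v p' V' v' \<Longrightarrow> a' \<in> pixels p' \<Longrightarrow>
       \<exists>a\<in>pixels p. similar b \<X> (Suc r) T (insert y F) p V (v(y := a)) p' V' (v'(y := a'))"
    by blast
  have body: "adjacent p a (v x) \<and> sat p (v(y := a)) V \<phi> \<longleftrightarrow> adjacent p' a' (v' x) \<and> sat p' (v'(y := a')) V' \<phi>"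
    if sim: "similar b \<X> (Suc r) T (insert y F) p V (v(y := a)) p' V' (v'(y := a'))" for p V v p' V' v' a a'
  proof -
    have "similar b \<X> r T (insert y F) p V (v(y := a)) p' V' (v'(y := a'))"
      using sim by (rule similar_mono) auto
    moreover have "adjacent p a (v x) \<longleftrightarrow> adjacent p' a' (v' x)"
    proof -
      have xy: "x \<noteq> y" "x \<in> F" using BEx.prems by auto
      then have "a \<in> pixels p" "v x \<in> pixels p" "a' \<in> pixels p'" "v' x \<in> pixels p'"
        using sim unfolding similar_def by (metis fun_upd_apply insertI1 insertI2)+
      moreover have "pos a = pos (v x) + e \<longleftrightarrow> pos a' = pos (v' x) + e" if e: "e \<in> unit_offsets" for e
        using similar_offset[OF sim _ _ unit_offset_in_box[OF e], of x y] xy by auto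
      ultimately show ?thesis by (simp add: adjacent_iff_pos)
    qed
    ultimately show ?thesis using 1 by blast
  qed
  have "sat p v V (BEx y x \<phi>) = sat p' v' V' (BEx y x \<phi>)"
    if sim: "similar b \<X> s S F p V v p' V' v'" for p V v p' V' v'
    unfolding sat.simps using 2(1)[OF sim] 2(2)[OF sim] body by meson
  then show ?case by blast
next
  case (SEx X k \<phi>)
  then show ?case by simp
qed

text \<open>Over the empty set of variables the local condition is vacuous, so only the window
  counts remain.\<close>

lemma FO_sentence_invariant_under_same_counts:
  assumes "isFO \<phi>" "wf b \<phi>" "fsv \<phi> \<subseteq> \<X> \<times> {1}" "fv \<phi> = {}"
  obtains r T where "\<And>p V v p' V' v'.
    same_counts r T (grid p) (label b \<X> p V) (grid p') (label b \<X> p' V') \<Longrightarrow> sat p v V \<phi> = sat p' v' V' \<phi>"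
proof -
  from FO_invariant_under_similar[OF assms(1-3), of "{}"] assms(4) obtain r T where
    "\<forall>p V v p' V' v'. similar b \<X> r T {} p V v p' V' v' \<longrightarrow> sat p v V \<phi> = sat p' v' V' \<phi>"
    by auto
  then have "sat p v V \<phi> = sat p' v' V' \<phi>"
    if "same_counts r T (grid p) (label b \<X> p V) (grid p') (label b \<X> p' V')" for p V v p' V' v'
    using that unfolding similar_def same_local_def by blast
  then show thesis by (rule that)
qed

section \<open>Properties definable by bounded formulas\<close>

type_synonym so_val = "nat \<Rightarrow> nat \<Rightarrow> pixel list set"

definition Conj :: "form \<Rightarrow> form \<Rightarrow> form" where
  "Conj \<phi> \<psi> = Neg (Disj (Neg \<phi>) (Neg \<psi>))"

lemma Conj_simps [simp]:
  "sat p v V (Conj \<phi> \<psi>) \<longleftrightarrow> sat p v V \<phi> \<and> sat p v V \<psi>"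
  "fv (Conj \<phi> \<psi>) = fv \<phi> \<union> fv \<psi>"
  "fsv (Conj \<phi> \<psi>) = fsv \<phi> \<union> fsv \<psi>"
  "wf b (Conj \<phi> \<psi>) \<longleftrightarrow> wf b \<phi> \<and> wf b \<psi>"
  "isBF (Conj \<phi> \<psi>) \<longleftrightarrow> isBF \<phi> \<and> isBF \<psi>"
  "noSO (Conj \<phi> \<psi>) \<longleftrightarrow> noSO \<phi> \<and> noSO \<psi>"
  by (auto simp: Conj_def)

text \<open>Asking for a formula for every variable \<open>x\<close> lets a property be restated at
  a fresh variable without any substitution lemma.\<close>

definition local_property :: "nat \<Rightarrow> (nat \<times> nat) set \<Rightarrow> (picture \<Rightarrow> so_val \<Rightarrow> pixel \<Rightarrow> bool) \<Rightarrow> bool" where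
  "local_property b S \<Pi> \<longleftrightarrow> (\<forall>x. \<exists>\<psi>. isBF \<psi> \<and> wf b \<psi> \<and> fv \<psi> \<subseteq> {x} \<and> fsv \<psi> \<subseteq> S \<and>
     (\<forall>p v V. v x \<in> pixels p \<longrightarrow> sat p v V \<psi> = \<Pi> p V (v x)))"

lemma local_propertyE:
  assumes "local_property b S \<Pi>"
  obtains \<psi> where "isBF \<psi>" "wf b \<psi>" "fv \<psi> \<subseteq> {x}" "fsv \<psi> \<subseteq> S"
     "\<And>p v V. v x \<in> pixels p \<Longrightarrow> sat p v V \<psi> = \<Pi> p V (v x)"
  using assms unfolding local_property_def by blast

lemma local_property_cong:
  assumes "local_property b S \<Pi>" "\<And>p V a. a \<in> pixels p \<Longrightarrow> \<Pi> p V a = \<Pi>' p V a"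
  shows "local_property b S \<Pi>'"
  using assms unfolding local_property_def by simp

lemma local_property_const: "local_property b S (\<lambda>p V a. c)"
  unfolding local_property_def
proof
  fix x show "\<exists>\<psi>. isBF \<psi> \<and> wf b \<psi> \<and> fv \<psi> \<subseteq> {x} \<and> fsv \<psi> \<subseteq> S \<and>
     (\<forall>p v V. v x \<in> pixels p \<longrightarrow> sat p v V \<psi> = c)"
    by (rule exI[of _ "if c then EqAt x x else Neg (EqAt x x)"]) simp
qed

lemma local_property_U: "1 \<le> k \<Longrightarrow> k \<le> b \<Longrightarrow> local_property b S (\<lambda>p V a. a \<in> Urel p k)"
  unfolding local_property_def
proof
  fix x assume "1 \<le> k" "k \<le> b"
  then show "\<exists>\<psi>. isBF \<psi> \<and> wf b \<psi> \<and> fv \<psi> \<subseteq> {x} \<and> fsv \<psi> \<subseteq> S \<and>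
     (\<forall>p v V. v x \<in> pixels p \<longrightarrow> sat p v V \<psi> = (v x \<in> Urel p k))"
    by (intro exI[of _ "UAt k x"]) simp
qed

lemma local_property_SO: "(X, 1) \<in> S \<Longrightarrow> local_property b S (\<lambda>p V a. [a] \<in> V X 1)"
  unfolding local_property_def
proof
  fix x assume "(X, 1) \<in> S"
  then show "\<exists>\<psi>. isBF \<psi> \<and> wf b \<psi> \<and> fv \<psi> \<subseteq> {x} \<and> fsv \<psi> \<subseteq> S \<and>
     (\<forall>p v V. v x \<in> pixels p \<longrightarrow> sat p v V \<psi> = ([v x] \<in> V X 1))"
    by (intro exI[of _ "SOAt X [x]"]) simp
qed

lemma local_property_not:
  assumes "local_property b S \<Pi>"
  shows "local_property b S (\<lambda>p V a. \<not> \<Pi> p V a)"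
  unfolding local_property_def
proof
  fix x
  from local_propertyE[OF assms, where x = x] obtain \<psi> where "isBF \<psi>" "wf b \<psi>" "fv \<psi> \<subseteq> {x}" "fsv \<psi> \<subseteq> S"
     "\<And>p v V. v x \<in> pixels p \<Longrightarrow> sat p v V \<psi> = \<Pi> p V (v x)" by blast
  then show "\<exists>\<psi>. isBF \<psi> \<and> wf b \<psi> \<and> fv \<psi> \<subseteq> {x} \<and> fsv \<psi> \<subseteq> S \<and>
     (\<forall>p v V. v x \<in> pixels p \<longrightarrow> sat p v V \<psi> = (\<not> \<Pi> p V (v x)))"
    by (intro exI[of _ "Neg \<psi>"]) simp
qed

lemma local_property_disj:
  assumes "local_property b S \<Pi>" "local_property b S \<Pi>'"
  shows "local_property b S (\<lambda>p V a. \<Pi> p V a \<or> \<Pi>' p V a)"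
  unfolding local_property_def
proof
  fix x
  from local_propertyE[OF assms(1), where x = x] obtain \<psi> where "isBF \<psi>" "wf b \<psi>" "fv \<psi> \<subseteq> {x}" "fsv \<psi> \<subseteq> S"
     "\<And>p v V. v x \<in> pixels p \<Longrightarrow> sat p v V \<psi> = \<Pi> p V (v x)" by blast
  moreover from local_propertyE[OF assms(2), where x = x] obtain \<psi>' where "isBF \<psi>'" "wf b \<psi>'" "fv \<psi>' \<subseteq> {x}" "fsv \<psi>' \<subseteq> S"
     "\<And>p v V. v x \<in> pixels p \<Longrightarrow> sat p v V \<psi>' = \<Pi>' p V (v x)" by blast
  ultimately show "\<exists>\<psi>. isBF \<psi> \<and> wf b \<psi> \<and> fv \<psi> \<subseteq> {x} \<and> fsv \<psi> \<subseteq> S \<and>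
     (\<forall>p v V. v x \<in> pixels p \<longrightarrow> sat p v V \<psi> = (\<Pi> p V (v x) \<or> \<Pi>' p V (v x)))"
    by (intro exI[of _ "Disj \<psi> \<psi>'"]) simp
qed

lemma local_property_conj:
  assumes "local_property b S \<Pi>" "local_property b S \<Pi>'"
  shows "local_property b S (\<lambda>p V a. \<Pi> p V a \<and> \<Pi>' p V a)"
  using local_property_not[OF local_property_disj[OF assms[THEN local_property_not]]]
  by (rule local_property_cong) blast

lemma local_property_imp:
  assumes "local_property b S \<Pi>" "local_property b S \<Pi>'"
  shows "local_property b S (\<lambda>p V a. \<Pi> p V a \<longrightarrow> \<Pi>' p V a)"
  using local_property_disj[OF local_property_not[OF assms(1)] assms(2)]
  by (rule local_property_cong) blast

lemma local_property_iff:
  assumes "local_property b S \<Pi>" "local_property b S \<Pi>'"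
  shows "local_property b S (\<lambda>p V a. \<Pi> p V a \<longleftrightarrow> \<Pi>' p V a)"
  using local_property_conj[OF local_property_imp[OF assms] local_property_imp[OF assms(2,1)]]
  by (rule local_property_cong) blast

lemma local_property_bex:
  assumes "finite I" "\<And>i. i \<in> I \<Longrightarrow> local_property b S (\<Pi> i)"
  shows "local_property b S (\<lambda>p V a. \<exists>i\<in>I. \<Pi> i p V a)"
  using assms
proof (induction I rule: finite_induct)
  case empty
  then show ?case by (simp add: local_property_const)
next
  case (insert i I)
  then have "local_property b S (\<lambda>p V a. \<Pi> i p V a \<or> (\<exists>i\<in>I. \<Pi> i p V a))"
    by (intro local_property_disj) auto
  then show ?case by simp
qed

lemma local_property_ball:
  assumes "finite I" "\<And>i. i \<in> I \<Longrightarrow> local_property b S (\<Pi> i)"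
  shows "local_property b S (\<lambda>p V a. \<forall>i\<in>I. \<Pi> i p V a)"
proof -
  have "local_property b S (\<lambda>p V a. \<not> (\<exists>i\<in>I. \<not> \<Pi> i p V a))"
    using assms by (intro local_property_not local_property_bex)
  then show ?thesis by simp
qed

text \<open>The family \<open>\<G>\<close> may be infinite, but only its members inside
  \<open>Pow I\<close> can be hit, so a finite disjunction over truth assignments suffices.\<close>

lemma local_property_boolean_combination:
  assumes "finite I" "\<And>i. i \<in> I \<Longrightarrow> local_property b S (\<Pi> i)"
  shows "local_property b S (\<lambda>p V a. {i \<in> I. \<Pi> i p V a} \<in> \<G>)"
proof -
  have "local_property b S (\<lambda>p V a. \<exists>G\<in>\<G> \<inter> Pow I. \<forall>i\<in>I. \<Pi> i p V a \<longleftrightarrow> i \<in> G)"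
    using assms
    by (intro local_property_bex local_property_ball local_property_iff local_property_const) auto
  then show ?thesis
  proof (rule local_property_cong)
    fix p V a
    show "(\<exists>G\<in>\<G> \<inter> Pow I. \<forall>i\<in>I. \<Pi> i p V a \<longleftrightarrow> i \<in> G) \<longleftrightarrow> {i \<in> I. \<Pi> i p V a} \<in> \<G>" (is "?L = ?R")
    proof
      assume ?L
      then obtain G where "G \<in> \<G>" "G = {i \<in> I. \<Pi> i p V a}" by blast
      then show ?R by simp
    next
      assume ?R
      then show ?L by (intro bexI[of _ "{i \<in> I. \<Pi> i p V a}"]) auto
    qed
  qed
qed

text \<open>False when the target lies outside the picture. Thus shifting the property
  \<open>True\<close> tests whether a pixel exists there, and the counting rules get their initial
  case at the border without a separate clause.\<close>

definition shift :: "offset \<Rightarrow> (picture \<Rightarrow> so_val \<Rightarrow> pixel \<Rightarrow> bool) \<Rightarrow> picture \<Rightarrow> so_val \<Rightarrow> pixel \<Rightarrow> bool" where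
  "shift d \<Pi> p V a \<longleftrightarrow> pos a + d \<in> grid p \<and> \<Pi> p V (unpos (pos a + d))"

lemma unit_offset_formula:
  assumes "e \<in> unit_offsets"
  obtains \<rho> where "isBF \<rho>" "wf b \<rho>" "fv \<rho> = {x, y}" "fsv \<rho> = {}"
    "\<And>p v V. v x \<in> pixels p \<Longrightarrow> v y \<in> pixels p \<Longrightarrow> sat p v V \<rho> \<longleftrightarrow> pos (v y) = pos (v x) + e"
proof -
  consider "e = (1, 0)" | "e = (0, 1)" | "e = (-1, 0)" | "e = (0, -1)"
    using assms by (auto simp: unit_offsets_def)
  then show thesis
  proof cases
    case 1 then show ?thesis
      by (intro that[of "RAt 1 x y"]) (simp_all add: Rrel_iff_pos[unfolded One_nat_def])
  next
    case 2 then show ?thesis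
      by (intro that[of "RAt 2 x y"]) (simp_all add: Rrel_iff_pos)
  next
    case 3 then show ?thesis
      by (intro that[of "RAt 1 y x"])
        (auto simp: Rrel_iff_pos[unfolded One_nat_def] prod_eq_iff)
  next
    case 4 then show ?thesis
      by (intro that[of "RAt 2 y x"]) (auto simp: Rrel_iff_pos prod_eq_iff)
  qed
qed

lemma local_property_shift_unit:
  assumes "local_property b S \<Pi>" "e \<in> unit_offsets"
  shows "local_property b S (shift e \<Pi>)"
  unfolding local_property_def
proof
  fix x
  let ?y = "Suc x"
  from local_propertyE[OF assms(1), where x = ?y] obtain \<psi> where \<psi>: "isBF \<psi>" "wf b \<psi>" "fv \<psi> \<subseteq> {?y}" "fsv \<psi> \<subseteq> S"
     "\<And>p v V. v ?y \<in> pixels p \<Longrightarrow> sat p v V \<psi> = \<Pi> p V (v ?y)" by blast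
  from unit_offset_formula[OF assms(2)] obtain \<rho> where
    \<rho>: "isBF \<rho>" "wf b \<rho>" "fv \<rho> = {x, ?y}" "fsv \<rho> = {}"
    "\<And>p v V. v x \<in> pixels p \<Longrightarrow> v ?y \<in> pixels p \<Longrightarrow> sat p v V \<rho> \<longleftrightarrow> pos (v ?y) = pos (v x) + e"
    by metis
  have "sat p v V (BEx ?y x (Conj \<rho> \<psi>)) = shift e \<Pi> p V (v x)" if "v x \<in> pixels p" for p v V
  proof -
    \<comment> \<open>The bounded quantifier does not fix the direction of the step; the conjunct
      \<open>\<rho>\<close> selects the neighbour at offset \<open>e\<close>.\<close>
    have "sat p v V (BEx ?y x (Conj \<rho> \<psi>)) \<longleftrightarrow>
        (\<exists>c\<in>pixels p. adjacent p c (v x) \<and> pos c = pos (v x) + e \<and> \<Pi> p V c)"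
      unfolding sat.simps using that \<psi>(5) \<rho>(5) by (intro bex_cong) auto
    also have "\<dots> \<longleftrightarrow> shift e \<Pi> p V (v x)"
    proof
      assume "\<exists>c\<in>pixels p. adjacent p c (v x) \<and> pos c = pos (v x) + e \<and> \<Pi> p V c"
      then show "shift e \<Pi> p V (v x)"
        unfolding shift_def by (metis pos_in_grid_iff unpos_pos)
    next
      assume *: "shift e \<Pi> p V (v x)"
      let ?c = "unpos (pos (v x) + e)"
      from * have c: "?c \<in> pixels p" "pos ?c = pos (v x) + e" "\<Pi> p V ?c"
        by (auto simp: shift_def unpos_in_pixels pos_unpos)
      moreover have "adjacent p ?c (v x)"
        using adjacent_iff_pos[OF c(1) that] assms(2) c(2) by blast
      ultimately show "\<exists>c\<in>pixels p. adjacent p c (v x) \<and> pos c = pos (v x) + e \<and> \<Pi> p V c"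
        by blast
    qed
    finally show ?thesis .
  qed
  then show "\<exists>\<psi>. isBF \<psi> \<and> wf b \<psi> \<and> fv \<psi> \<subseteq> {x} \<and> fsv \<psi> \<subseteq> S \<and>
     (\<forall>p v V. v x \<in> pixels p \<longrightarrow> sat p v V \<psi> = shift e \<Pi> p V (v x))"
    using \<psi> \<rho> by (intro exI[of _ "BEx ?y x (Conj \<rho> \<psi>)"]) auto
qed

text \<open>Two successive shifts also demand that the intermediate pixel exists. The sign
  conditions make this demand follow from the existence of the target.\<close>

lemma local_property_shift_add:
  assumes "local_property b S (shift e (shift d \<Pi>))"
    and "0 \<le> fst e \<and> 0 \<le> fst d \<or> fst e \<le> 0 \<and> fst d \<le> 0"
    and "0 \<le> snd e \<and> 0 \<le> snd d \<or> snd e \<le> 0 \<and> snd d \<le> 0"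
  shows "local_property b S (shift (e + d) \<Pi>)"
  using assms(1)
proof (rule local_property_cong)
  fix p :: picture and V a
  assume "a \<in> pixels p"
  then have "pos a \<in> grid p" by simp
  then have "pos a + e \<in> grid p" if "pos a + (e + d) \<in> grid p"
    using that assms(2,3) by (rule grid_monotone_path)
  then show "shift e (shift d \<Pi>) p V a = shift (e + d) \<Pi> p V a"
    by (auto simp: shift_def pos_unpos add.assoc)
qed

text \<open>The walk goes vertically first and then horizontally, each leg in unit steps of constant
  sign, so it stays inside the picture whenever its end does.\<close>

lemma local_property_shift:
  assumes "local_property b S \<Pi>"
  shows "local_property b S (shift d \<Pi>)"
proof -
  have shift0: "local_property b S (shift 0 \<Pi>)" if "local_property b S \<Pi>" for \<Pi>
    using that by (rule local_property_cong) (simp add: shift_def)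
  have down: "local_property b S (shift (int n, 0) \<Pi>)" if "local_property b S \<Pi>" for n \<Pi>
  proof (induction n)
    case (Suc n)
    from local_property_shift_add[OF local_property_shift_unit[OF Suc, of "(1, 0)"]]
    show ?case by (simp add: unit_offsets_def add.commute)
  qed (use shift0[OF that] in \<open>simp add: zero_prod_def\<close>)
  have up: "local_property b S (shift (- int n, 0) \<Pi>)" if "local_property b S \<Pi>" for n \<Pi>
  proof (induction n)
    case (Suc n)
    from local_property_shift_add[OF local_property_shift_unit[OF Suc, of "(-1, 0)"]]
    show ?case by (simp add: unit_offsets_def add.commute)
  qed (use shift0[OF that] in \<open>simp add: zero_prod_def\<close>)
  have right: "local_property b S (shift (0, int n) \<Pi>)" if "local_property b S \<Pi>" for n \<Pi>
  proof (induction n)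
    case (Suc n)
    from local_property_shift_add[OF local_property_shift_unit[OF Suc, of "(0, 1)"]]
    show ?case by (simp add: unit_offsets_def add.commute)
  qed (use shift0[OF that] in \<open>simp add: zero_prod_def\<close>)
  have left: "local_property b S (shift (0, - int n) \<Pi>)" if "local_property b S \<Pi>" for n \<Pi>
  proof (induction n)
    case (Suc n)
    from local_property_shift_add[OF local_property_shift_unit[OF Suc, of "(0, -1)"]]
    show ?case by (simp add: unit_offsets_def add.commute)
  qed (use shift0[OF that] in \<open>simp add: zero_prod_def\<close>)
  have vert: "local_property b S (shift (i, 0) \<Pi>)" if "local_property b S \<Pi>" for i \<Pi>
    using down[OF that] up[OF that] by (cases i rule: int_cases2) simp_all
  have horiz: "local_property b S (shift (0, j) \<Pi>)" if "local_property b S \<Pi>" for j \<Pi>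
    using right[OF that] left[OF that] by (cases j rule: int_cases2) simp_all
  have "local_property b S (shift ((fst d, 0) + (0, snd d)) \<Pi>)"
    by (rule local_property_shift_add[OF vert[OF horiz[OF assms]]]) auto
  then show ?thesis by simp
qed

lemma local_property_label:
  assumes "\<X> \<times> {1} \<subseteq> S" "finite \<X>"
  shows "local_property b S (\<lambda>p V a. label b \<X> p V (pos a) = l)"
proof -
  obtain K Y where [simp]: "l = (K, Y)" by fastforce
  \<comment> \<open>The constant conjunct rejects values \<open>l\<close> that no label can take;
    the other conjuncts only compare inside the two ranges.\<close>
  have "local_property b S (\<lambda>p V a. (K \<subseteq> {1..b} \<and> Y \<subseteq> \<X>) \<and> (\<forall>k\<in>{1..b}. a \<in> Urel p k \<longleftrightarrow> k \<in> K) \<and>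
      (\<forall>X\<in>\<X>. [a] \<in> V X 1 \<longleftrightarrow> X \<in> Y))"
    using assms
    by (intro local_property_conj local_property_ball local_property_iff local_property_const
        local_property_U local_property_SO) auto
  then show ?thesis
    by (rule local_property_cong) (auto simp: label_def)
qed

lemma local_property_window:
  assumes "\<X> \<times> {1} \<subseteq> S" "finite \<X>"
  shows "local_property b S (\<lambda>p V a. window (grid p) (label b \<X> p V) r (pos a) = w)"
proof -
  let ?at = "\<lambda>d p V a. case w d of None \<Rightarrow> \<not> shift d (\<lambda>_ _ _. True) p V a
        | Some l \<Rightarrow> shift d (\<lambda>p V a. label b \<X> p V (pos a) = l) p V a"
  have "local_property b S (?at d)" for d
    using assms by (cases "w d") (simp_all add: local_property_const local_property_label
        local_property_shift local_property_not)
  then have "local_property b S (\<lambda>p V a. (\<forall>d. d \<notin> box r \<longrightarrow> w d = None) \<and> (\<forall>d\<in>box r. ?at d p V a))"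
    by (intro local_property_conj local_property_ball local_property_const) auto
  then show ?thesis
  proof (rule local_property_cong)
    fix p V a
    have "?at d p V a \<longleftrightarrow> window (grid p) (label b \<X> p V) r (pos a) d = w d" if "d \<in> box r" for d
      using that by (cases "w d") (auto simp: window_def shift_def pos_unpos)
    moreover have "window (grid p) (label b \<X> p V) r (pos a) d = None" if "d \<notin> box r" for d
      using that by (simp add: window_def)
    ultimately show "(\<forall>d. d \<notin> box r \<longrightarrow> w d = None) \<and> (\<forall>d\<in>box r. ?at d p V a) \<longleftrightarrow>
        window (grid p) (label b \<X> p V) r (pos a) = w"
      unfolding fun_eq_iff[of _ w] by (smt (verit, best))
  qed
qed

section \<open>Quantifier blocks and threshold counting\<close>

definition block :: "bool \<Rightarrow> (nat \<times> nat) list \<Rightarrow> form \<Rightarrow> form" where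
  "block ex qs \<psi> = foldr (\<lambda>q \<chi>. if ex then SEx (fst q) (snd q) \<chi> else SAll (fst q) (snd q) \<chi>) qs \<psi>"

text \<open>Treating a whole block as one change of the valuation makes the order and repetition of
  its variables irrelevant: only the set of names counts.\<close>

definition agree_off :: "picture \<Rightarrow> (nat \<times> nat) set \<Rightarrow> so_val \<Rightarrow> so_val \<Rightarrow> bool" where
  "agree_off p Q V V' \<longleftrightarrow> (\<forall>X k. if (X, k) \<in> Q then V' X k \<subseteq> {as. length as = k \<and> set as \<subseteq> pixels p}
     else V' X k = V X k)"

lemma ex_agree_off_insert:
  "(\<exists>S. S \<subseteq> {as. length as = k \<and> set as \<subseteq> pixels p} \<and>
      (\<exists>V'. agree_off p Q (V(X := (V X)(k := S))) V' \<and> P V'))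
    \<longleftrightarrow> (\<exists>V'. agree_off p (insert (X, k) Q) V V' \<and> P V')" (is "?L \<longleftrightarrow> ?R")
proof
  assume ?L
  then obtain S V' where *: "S \<subseteq> {as. length as = k \<and> set as \<subseteq> pixels p}"
    "agree_off p Q (V(X := (V X)(k := S))) V'" "P V'" by blast
  have "if (Y, l) \<in> insert (X, k) Q then V' Y l \<subseteq> {as. length as = l \<and> set as \<subseteq> pixels p}
      else V' Y l = V Y l" for Y l
    using *(1) *(2)[unfolded agree_off_def, rule_format, of Y l] by (auto split: if_splits)
  then have "agree_off p (insert (X, k) Q) V V'"
    by (simp add: agree_off_def)
  with * show ?R by blast
next
  assume ?R
  then obtain V' where *: "agree_off p (insert (X, k) Q) V V'" "P V'" by blast
  note agree = *(1)[unfolded agree_off_def, rule_format]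
  have "if (Y, l) \<in> Q then V' Y l \<subseteq> {as. length as = l \<and> set as \<subseteq> pixels p}
      else V' Y l = (V(X := (V X)(k := V' X k))) Y l" for Y l
    using agree[of Y l] by (cases "(Y, l) = (X, k)") (auto split: if_splits)
  then have "agree_off p Q (V(X := (V X)(k := V' X k))) V'"
    by (simp add: agree_off_def)
  moreover have "V' X k \<subseteq> {as. length as = k \<and> set as \<subseteq> pixels p}"
    using agree[of X k] by simp
  ultimately show ?L
    using *(2) by blast
qed

lemma block_Nil [simp]: "block ex [] \<psi> = \<psi>"
  by (simp add: block_def)

lemma block_Cons [simp]:
  "block ex (q # qs) \<psi> =
    (if ex then SEx (fst q) (snd q) (block ex qs \<psi>) else SAll (fst q) (snd q) (block ex qs \<psi>))"
  by (simp add: block_def)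

lemma block_append: "block ex (qs @ qs') \<psi> = block ex qs (block ex qs' \<psi>)"
  by (simp add: block_def)

lemma hier_Suc_iff:
  "hier base mon ex (Suc l) \<phi> \<longleftrightarrow>
    (\<exists>qs \<psi>. (mon \<longrightarrow> (\<forall>q\<in>set qs. snd q = 1)) \<and> hier base mon (\<not> ex) l \<psi> \<and> \<phi> = block ex qs \<psi>)"
  by (simp add: block_def)

declare hier.simps(2) [simp del]

lemma sat_block:
  "sat p v V (block ex qs \<psi>) \<longleftrightarrow>
    (if ex then \<exists>V'. agree_off p (set qs) V V' \<and> sat p v V' \<psi>
     else \<forall>V'. agree_off p (set qs) V V' \<longrightarrow> sat p v V' \<psi>)"
proof (induction qs arbitrary: V)
  case Nil
  have "agree_off p {} V V' \<longleftrightarrow> V' = V" for V'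
    by (auto simp: agree_off_def fun_eq_iff)
  then show ?case by simp
next
  case (Cons q qs)
  note ins = ex_agree_off_insert[of "snd q" p "set qs" V "fst q"]
  show ?case
  proof (cases ex)
    case True
    with Cons.IH ins[of "\<lambda>V'. sat p v V' \<psi>"] show ?thesis by simp
  next
    case False
    with Cons.IH ins[of "\<lambda>V'. \<not> sat p v V' \<psi>"] show ?thesis
      by (simp add: SAll_def)
  qed
qed

lemma block_simps [simp]:
  "fv (block ex qs \<psi>) = fv \<psi>"
  "fsv (block ex qs \<psi>) = fsv \<psi> - set qs"
  "wf b (block ex qs \<psi>) = wf b \<psi>"
  by (induction qs) (auto simp: SAll_def)

lemma All1_simps [simp]:
  "fv (All1 x \<phi>) = fv \<phi> - {x}" "fsv (All1 x \<phi>) = fsv \<phi>" "wf b (All1 x \<phi>) = wf b \<phi>"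
  "sat p v V (All1 x \<phi>) \<longleftrightarrow> (\<forall>a\<in>pixels p. sat p (v(x := a)) V \<phi>)"
  by (simp_all add: All1_def)

section \<open>Threshold counts over rectangles by local recursion\<close>

fun row_count :: "(nat \<times> nat \<Rightarrow> bool) \<Rightarrow> nat \<Rightarrow> nat \<Rightarrow> nat" where
  "row_count \<kappa> i 0 = 0"
| "row_count \<kappa> i (Suc j) = row_count \<kappa> i j + of_bool (\<kappa> (i, Suc j))"

fun rect_count :: "(nat \<times> nat \<Rightarrow> bool) \<Rightarrow> nat \<Rightarrow> nat \<Rightarrow> nat" where
  "rect_count \<kappa> 0 j = 0"
| "rect_count \<kappa> (Suc i) j = rect_count \<kappa> i j + row_count \<kappa> (Suc i) j"

lemma row_count_eq_card: "row_count \<kappa> i n = card {j \<in> {1..n}. \<kappa> (i, j)}"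
proof (induction n)
  case (Suc n)
  have "{j \<in> {1..Suc n}. \<kappa> (i, j)} =
      (if \<kappa> (i, Suc n) then insert (Suc n) {j \<in> {1..n}. \<kappa> (i, j)} else {j \<in> {1..n}. \<kappa> (i, j)})"
    by (auto simp: le_Suc_eq)
  with Suc show ?case by simp
qed simp

lemma rect_count_eq_card: "rect_count \<kappa> m n = card {a \<in> pixels (m, n, f). \<kappa> a}"
proof (induction m)
  case 0
  have "{a \<in> pixels (0, n, f). \<kappa> a} = {}"
    by (auto simp: pixels_def)
  then show ?case by (simp only: card.empty rect_count.simps)
next
  case (Suc m)
  have "{a \<in> pixels (Suc m, n, f). \<kappa> a} =
      {a \<in> pixels (m, n, f). \<kappa> a} \<union> Pair (Suc m) ` {j \<in> {1..n}. \<kappa> (Suc m, j)}"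
    by (auto simp: pixels_def le_Suc_eq)
  moreover have "finite {a \<in> pixels (m, n, f). \<kappa> a}"
    by (rule finite_subset[of _ "{1..m} \<times> {1..n}"]) (auto simp: pixels_def)
  ultimately have "card {a \<in> pixels (Suc m, n, f). \<kappa> a} =
      card {a \<in> pixels (m, n, f). \<kappa> a} + card (Pair (Suc m) ` {j \<in> {1..n}. \<kappa> (Suc m, j)})"
    by (subst card_Un_disjoint[symmetric]) (auto simp: pixels_def)
  with Suc show ?case
    by (simp add: row_count_eq_card card_image inj_on_def)
qed

text \<open>Local rules know a summand only through its comparisons with positive thresholds. If
  neither summand reaches \<open>t\<close> alone, then \<open>s = x\<close> splits \<open>t\<close>;
  the first two disjuncts replace the missing threshold 0.\<close>

lemma le_add_iff_split:
  fixes t :: nat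
  assumes "1 \<le> t"
  shows "t \<le> x + y \<longleftrightarrow> t \<le> y \<or> t \<le> x \<or> (\<exists>s\<in>{1..<t}. s \<le> x \<and> t - s \<le> y)"
proof
  assume "t \<le> x + y"
  show "t \<le> y \<or> t \<le> x \<or> (\<exists>s\<in>{1..<t}. s \<le> x \<and> t - s \<le> y)"
  proof (rule ccontr)
    assume "\<not> ?thesis"
    then have "x < t" "y < t" "\<forall>s\<in>{1..<t}. \<not> (s \<le> x \<and> t - s \<le> y)" by auto
    with \<open>t \<le> x + y\<close> show False by (auto dest!: bspec[of _ _ x])
  qed
qed auto

lemma le_add_iff_threshold:
  fixes t :: nat
  assumes P: "\<And>s. s \<in> {1..T} \<Longrightarrow> P s \<longleftrightarrow> s \<le> x" and Q: "\<And>s. s \<in> {1..T} \<Longrightarrow> Q s \<longleftrightarrow> s \<le> y"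
    and t: "t \<in> {1..T}"
  shows "Q t \<or> P t \<or> (\<exists>s\<in>{1..<t}. P s \<and> Q (t - s)) \<longleftrightarrow> t \<le> x + y"
proof -
  have "(\<exists>s\<in>{1..<t}. P s \<and> Q (t - s)) \<longleftrightarrow> (\<exists>s\<in>{1..<t}. s \<le> x \<and> t - s \<le> y)"
  proof (rule bex_cong)
    fix s assume "s \<in> {1..<t}"
    then have "s \<in> {1..T}" "t - s \<in> {1..T}" using t by auto
    then show "P s \<and> Q (t - s) \<longleftrightarrow> s \<le> x \<and> t - s \<le> y" using P Q by blast
  qed simp
  then show ?thesis
    using le_add_iff_split[of t x y] P[OF t] Q[OF t] t by simp
qed

text \<open>Every value is forced by the pixel to the left, so the rules have the true prefix counts
  as their only solution. The case \<open>t = 1\<close> is separate because there is no relation for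
  threshold 0, and \<open>1 < j\<close> says that a left neighbour exists.\<close>

lemma row_recursion_iff:
  "(\<forall>i\<in>{1..m}. \<forall>j\<in>{1..n}. \<forall>t\<in>{1..T}. Z t i j \<longleftrightarrow>
      (1 < j \<and> Z t i (j - 1)) \<or> (\<kappa> (i, j) \<and> (t = 1 \<or> 1 < j \<and> Z (t - 1) i (j - 1)))) \<longleftrightarrow>
   (\<forall>i\<in>{1..m}. \<forall>j\<in>{1..n}. \<forall>t\<in>{1..T}. Z t i j \<longleftrightarrow> t \<le> row_count \<kappa> i j)"
  (is "?L \<longleftrightarrow> ?R")
proof
  assume L: ?L
  have "i \<in> {1..m} \<Longrightarrow> j \<in> {1..n} \<Longrightarrow> t \<in> {1..T} \<Longrightarrow> Z t i j \<longleftrightarrow> t \<le> row_count \<kappa> i j" for i j t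
  proof (induction j arbitrary: t)
    case (Suc j)
    have "Z t i (Suc j) \<longleftrightarrow> (0 < j \<and> Z t i j) \<or> (\<kappa> (i, Suc j) \<and> (t = 1 \<or> 0 < j \<and> Z (t - 1) i j))"
      using L Suc.prems by auto
    \<comment> \<open>At \<open>j = 0\<close> both sides fail: there is no pixel, and no threshold
      from 1 on is met by an empty prefix.\<close>
    moreover have "0 < j \<and> Z s i j \<longleftrightarrow> s \<le> row_count \<kappa> i j" if "s \<in> {1..T}" for s
      using Suc.IH[of s] Suc.prems that by (cases j) auto
    moreover have "t \<in> {1..T}" "t = 1 \<or> t - 1 \<in> {1..T}"
      using Suc.prems(3) by auto
    ultimately have "Z t i (Suc j) \<longleftrightarrow> t \<le> row_count \<kappa> i j \<or> (\<kappa> (i, Suc j) \<and> (t = 1 \<or> t - 1 \<le> row_count \<kappa> i j))"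
      by blast
    with Suc.prems show ?case by auto
  qed simp
  then show ?R by blast
next
  assume R: ?R
  show ?L
  proof (intro ballI)
    fix i j t assume ijt: "i \<in> {1..m}" "j \<in> {1..n}" "t \<in> {1..T}"
    then obtain j' where [simp]: "j = Suc j'" by (cases j) auto
    have prev: "0 < j' \<and> Z s i j' \<longleftrightarrow> s \<le> row_count \<kappa> i j'" if "s \<in> {1..T}" for s
      using R ijt that by (cases j') auto
    have "t = 1 \<or> t - 1 \<in> {1..T}"
      using ijt(3) by auto
    with prev[OF ijt(3)] prev[of "t - 1"]
    have "0 < j' \<and> Z t i j' \<longleftrightarrow> t \<le> row_count \<kappa> i j'"
      "t = 1 \<or> (0 < j' \<and> Z (t - 1) i j' \<longleftrightarrow> t - 1 \<le> row_count \<kappa> i j')"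
      by blast+
    moreover have "Z t i j \<longleftrightarrow> t \<le> row_count \<kappa> i j' + of_bool (\<kappa> (i, j))"
      using R ijt by auto
    ultimately show "Z t i j \<longleftrightarrow>
        (1 < j \<and> Z t i (j - 1)) \<or> (\<kappa> (i, j) \<and> (t = 1 \<or> 1 < j \<and> Z (t - 1) i (j - 1)))"
      by (cases "t = 1"; cases "\<kappa> (i, j)") auto
  qed
qed

text \<open>The rectangle ending at a pixel is the one ending above it plus the prefix of its own
  row. Given correct row counts, this forces the solution by induction down each column.\<close>

lemma rect_recursion_iff:
  assumes row: "\<forall>i\<in>{1..m}. \<forall>j\<in>{1..n}. \<forall>t\<in>{1..T}. Z t i j \<longleftrightarrow> t \<le> row_count \<kappa> i j"
  shows "(\<forall>i\<in>{1..m}. \<forall>j\<in>{1..n}. \<forall>t\<in>{1..T}. W t i j \<longleftrightarrow>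
      Z t i j \<or> (1 < i \<and> W t (i - 1) j) \<or> (\<exists>s\<in>{1..<t}. (1 < i \<and> W s (i - 1) j) \<and> Z (t - s) i j)) \<longleftrightarrow>
   (\<forall>i\<in>{1..m}. \<forall>j\<in>{1..n}. \<forall>t\<in>{1..T}. W t i j \<longleftrightarrow> t \<le> rect_count \<kappa> i j)"
  (is "?L \<longleftrightarrow> ?R")
proof
  assume L: ?L
  have "i \<in> {1..m} \<Longrightarrow> j \<in> {1..n} \<Longrightarrow> t \<in> {1..T} \<Longrightarrow> W t i j \<longleftrightarrow> t \<le> rect_count \<kappa> i j" for i j t
  proof (induction i arbitrary: t)
    case (Suc i)
    have W: "0 < i \<and> W s i j \<longleftrightarrow> s \<le> rect_count \<kappa> i j" if "s \<in> {1..T}" for s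
      using Suc.IH[of s] Suc.prems that by (cases i) auto
    have Z: "Z s (Suc i) j \<longleftrightarrow> s \<le> row_count \<kappa> (Suc i) j" if "s \<in> {1..T}" for s
      using row Suc.prems that by blast
    have "W t (Suc i) j \<longleftrightarrow> Z t (Suc i) j \<or> (0 < i \<and> W t i j) \<or>
        (\<exists>s\<in>{1..<t}. (0 < i \<and> W s i j) \<and> Z (t - s) (Suc i) j)"
      using L Suc.prems by auto
    also have "\<dots> \<longleftrightarrow> t \<le> rect_count \<kappa> i j + row_count \<kappa> (Suc i) j"
      using W Z Suc.prems(3) by (rule le_add_iff_threshold)
    finally show ?case by simp
  qed simp
  then show ?R by blast
next
  assume R: ?R
  show ?L
  proof (intro ballI)
    fix i j t assume ijt: "i \<in> {1..m}" "j \<in> {1..n}" "t \<in> {1..T}"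
    then obtain i' where [simp]: "i = Suc i'" by (cases i) auto
    have W: "0 < i' \<and> W s i' j \<longleftrightarrow> s \<le> rect_count \<kappa> i' j" if "s \<in> {1..T}" for s
      using R ijt that by (cases i') auto
    have Z: "Z s i j \<longleftrightarrow> s \<le> row_count \<kappa> i j" if "s \<in> {1..T}" for s
      using row ijt that by blast
    have "W t i j \<longleftrightarrow> t \<le> rect_count \<kappa> i' j + row_count \<kappa> i j"
      using R ijt by auto
    also have "\<dots> \<longleftrightarrow> Z t i j \<or> (0 < i' \<and> W t i' j) \<or> (\<exists>s\<in>{1..<t}. (0 < i' \<and> W s i' j) \<and> Z (t - s) i j)"
      using le_add_iff_threshold[OF W Z ijt(3)] by blast
    finally show "W t i j \<longleftrightarrow> Z t i j \<or> (1 < i \<and> W t (i - 1) j) \<or>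
        (\<exists>s\<in>{1..<t}. (1 < i \<and> W s (i - 1) j) \<and> Z (t - s) i j)"
      by simp
  qed
qed

lemma shift_pixel_simps:
  assumes "i \<in> {1..m}" "j \<in> {1..n}"
  shows "shift (0, -1) \<Pi> (m, n, f) V (i, j) \<longleftrightarrow> 1 < j \<and> \<Pi> (m, n, f) V (i, j - 1)"
    "shift (-1, 0) \<Pi> (m, n, f) V (i, j) \<longleftrightarrow> 1 < i \<and> \<Pi> (m, n, f) V (i - 1, j)"
    "shift (0, 1) \<Pi> (m, n, f) V (i, j) \<longleftrightarrow> j < n \<and> \<Pi> (m, n, f) V (i, j + 1)"
    "shift (1, 0) \<Pi> (m, n, f) V (i, j) \<longleftrightarrow> i < m \<and> \<Pi> (m, n, f) V (i + 1, j)"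
  using assms by (auto simp: shift_def grid_eq pos_def unpos_def nat_diff_distrib nat_add_distrib)

lemma ball_pixels_iff: "(\<forall>a\<in>pixels (m, n, f). P a) \<longleftrightarrow> (\<forall>i\<in>{1..m}. \<forall>j\<in>{1..n}. P (i, j))"
  by (auto simp: pixels_def)

text \<open>The index carries the radius along with the window because \<open>same_counts\<close>
  compares windows of several radii.\<close>

definition pixel_window :: "nat \<Rightarrow> nat set \<Rightarrow> nat \<times> (offset \<Rightarrow> (nat set \<times> nat set) option) \<Rightarrow> picture \<Rightarrow> so_val \<Rightarrow> pixel \<Rightarrow> bool" where
  "pixel_window b \<X> \<kappa> p V a \<longleftrightarrow> window (grid p) (label b \<X> p V) (fst \<kappa>) (pos a) = snd \<kappa>"

text \<open>If the truncated values differ, the successor of the smaller number is a threshold that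
  separates them.\<close>

lemma min_eq_min_iff:
  "min T c = min T d \<longleftrightarrow> (\<forall>t\<in>{1..T}. t \<le> c \<longleftrightarrow> t \<le> d)" for T c d :: nat
proof
  assume R: "\<forall>t\<in>{1..T}. t \<le> c \<longleftrightarrow> t \<le> d"
  show "min T c = min T d"
  proof (rule ccontr)
    assume "min T c \<noteq> min T d"
    then consider "c < T" "c < d" | "d < T" "d < c" by linarith
    then show False
      using R by cases (auto dest: bspec[of _ _ "Suc c"] bspec[of _ _ "Suc d"])
  qed
qed auto

lemma card_grid_window_eq:
  "card {u \<in> grid p. window (grid p) (label b \<X> p V) r u = w} = card {a \<in> pixels p. pixel_window b \<X> (r, w) p V a}"
proof -
  have "{u \<in> grid p. window (grid p) (label b \<X> p V) r u = w} = pos ` {a \<in> pixels p. pixel_window b \<X> (r, w) p V a}"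
    by (auto simp: pixel_window_def grid_def)
  then show ?thesis by (simp add: card_image inj_on_def)
qed

text \<open>Equal truncated counts mean equal truth values, and only finitely many windows occur, so
  a finite profile of threshold facts decides the sentence. \<open>\<G>\<close> collects the
  profiles of its models.\<close>

lemma FO_threshold_form:
  assumes "isFO \<psi>" "wf b \<psi>" "fsv \<psi> \<subseteq> \<X> \<times> {1}" "fv \<psi> = {}" "finite \<X>"
  obtains K T \<G> where "finite K" "\<And>p v V. sat p v V \<psi> \<longleftrightarrow>
    {j \<in> K \<times> {1..T}. snd j \<le> card {a \<in> pixels p. pixel_window b \<X> (fst j) p V a}} \<in> \<G>"
proof -
  from FO_sentence_invariant_under_same_counts[OF assms(1-4)] obtain r T where inv:
    "\<And>p V v p' V' v'. same_counts r T (grid p) (label b \<X> p V) (grid p') (label b \<X> p' V') \<Longrightarrow>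
      sat p v V \<psi> = sat p' v' V' \<psi>" by metis
  let ?L = "insert None (Some ` (Pow {1..b} \<times> Pow \<X>))"
  define K where "K = {..r} \<times> {w. \<forall>d. (d \<in> box r \<longrightarrow> w d \<in> ?L) \<and> (d \<notin> box r \<longrightarrow> w d = None)}"
  have finK: "finite K"
    unfolding K_def using assms(5) by (intro finite_cartesian_product finite_set_of_finite_funs) auto
  define count where "count \<kappa> p V = card {a \<in> pixels p. pixel_window b \<X> \<kappa> p V a}" for \<kappa> p V
  define prof where "prof p V = {j \<in> K \<times> {1..T}. snd j \<le> count (fst j) p V}" for p V
  \<comment> \<open>\<open>same_counts\<close> speaks of every function \<open>w\<close>, but
    functions outside \<open>K\<close> are not windows of labelled pictures and contribute only
    zeros.\<close>
  have count0: "count (q, w) p V = 0" if "q \<le> r" "(q, w) \<notin> K" for q w p V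
  proof -
    have "(q, window (grid p) (label b \<X> p V) q (pos a)) \<in> K" for a
      using that(1) by (auto simp: K_def window_def label_def dest: box_mono)
    with that(2) have "{a \<in> pixels p. pixel_window b \<X> (q, w) p V a} = {}"
      by (auto simp: pixel_window_def)
    then show ?thesis by (simp only: count_def card.empty)
  qed
  have key: "sat p v V \<psi> = sat p' v' V' \<psi>" if "prof p V = prof p' V'" for p V v p' V' v'
  proof (rule inv)
    have "min T (count (q, w) p V) = min T (count (q, w) p' V')" if "q \<le> r" for q w
    proof (cases "(q, w) \<in> K")
      case True
      have "t \<le> count (q, w) p V \<longleftrightarrow> ((q, w), t) \<in> prof p V" if "t \<in> {1..T}" for t p V
        using True that by (simp add: prof_def)
      then show ?thesis
        using \<open>prof p V = prof p' V'\<close> unfolding min_eq_min_iff by blast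
    qed (use that count0 in simp)
    then show "same_counts r T (grid p) (label b \<X> p V) (grid p') (label b \<X> p' V')"
      by (simp add: same_counts_def card_grid_window_eq count_def)
  qed
  show thesis
  proof (rule that[OF finK])
    fix p v V
    have "sat p v V \<psi> \<longleftrightarrow> prof p V \<in> {prof p V | p V v. sat p v V \<psi>}"
      using key by blast
    then show "sat p v V \<psi> \<longleftrightarrow> {j \<in> K \<times> {1..T}. snd j \<le> card {a \<in> pixels p. pixel_window b \<X> (fst j) p V a}} \<in>
        {prof p V | p V v. sat p v V \<psi>}"
      unfolding prof_def count_def .
  qed
qed

section \<open>From first-order to local matrices\<close>

lemma finite_fsv: "finite (fsv \<phi>)"
  by (induction \<phi>) auto

lemma label_cong:
  assumes "\<And>X. X \<in> \<X> \<Longrightarrow> V X 1 = V' X 1"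
  shows "label b \<X> p V = label b \<X> p V'"
  using assms by (auto simp: label_def fun_eq_iff)

lemma corner_iff:
  assumes "a \<in> pixels (m, n, f)"
  shows "\<not> shift (0, 1) (\<lambda>_ _ _. True) (m, n, f) V a \<and> \<not> shift (1, 0) (\<lambda>_ _ _. True) (m, n, f) V a \<longleftrightarrow> a = (m, n)"
proof -
  obtain i j where a: "a = (i, j)" "i \<in> {1..m}" "j \<in> {1..n}"
    using assms by (auto simp: pixels_def)
  show ?thesis
    unfolding a(1) shift_pixel_simps[OF a(2,3)] using a(2,3) by auto
qed

lemma ball_conj3:
  assumes "\<And>a. a \<in> A \<Longrightarrow> C a \<longleftrightarrow> P a \<and> Q a \<and> R a"
  shows "(\<forall>a\<in>A. C a) \<longleftrightarrow> (\<forall>a\<in>A. P a) \<and> (\<forall>a\<in>A. Q a) \<and> (\<forall>a\<in>A. R a)"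
  using assms by blast

lemma ball_pixels_rotate:
  "(\<forall>a\<in>pixels (m, n, f). \<forall>\<kappa>\<in>K. P \<kappa> a) \<longleftrightarrow> (\<forall>\<kappa>\<in>K. \<forall>i\<in>{1..m}. \<forall>j\<in>{1..n}. P \<kappa> (i, j))"
  unfolding ball_pixels_iff by blast

text \<open>The guessed relations are counters, and a single first-order variable suffices for the
  matrix: each pixel checks its own counters against its neighbours, and the bottom right one also
  looks up the profile in \<open>\<G>\<close>.\<close>

lemma FO_to_existential_LFO:
  assumes "isFO \<psi>" "wf b \<psi>" "fsv \<psi> \<subseteq> UNIV \<times> {1}" "fv \<psi> = {}"
  obtains qs \<chi> where "isLFO \<chi>" "wf b \<chi>" "fv \<chi> = {}" "fsv \<chi> - set qs \<subseteq> fsv \<psi>"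
    "\<And>p v V. p \<in> PIC b \<Longrightarrow> sat p v V \<psi> \<longleftrightarrow> sat p v V (block True qs \<chi>)"
proof -
  define \<X> where "\<X> = fst ` fsv \<psi>"
  have fsv: "fsv \<psi> = \<X> \<times> {1}"
    using assms(3) by (force simp: \<X>_def)
  have fin: "finite \<X>"
    by (simp add: \<X>_def finite_fsv)
  obtain K T \<G> where
    finK: "finite K" and thr: "\<And>p v V. sat p v V \<psi> \<longleftrightarrow>
    {j \<in> K \<times> {1..T}. snd j \<le> card {a \<in> pixels p. pixel_window b \<X> (fst j) p V a}} \<in> \<G>"
    by (rule FO_threshold_form[OF assms(1,2) equalityD1[OF fsv] assms(4) fin]) blast
  define J where "J = K \<times> {1..T}"
  have finJ: "finite J" by (simp add: J_def finK)
  from finite_imp_inj_to_nat_seg[OF this] obtain h :: "_ \<Rightarrow> nat" where h: "inj_on h J" by blast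
  define N where "N = Suc (Max (insert 0 \<X>))"
  have N: "X < N" if "X \<in> \<X>" for X
    using fin that by (simp add: N_def less_Suc_eq_le)
  \<comment> \<open>\<open>zr (\<kappa>, t)\<close> names the set of pixels \<open>(i, j)\<close> such that \<open>\<kappa>\<close> occurs at least \<open>t\<close> times among the
    first \<open>j\<close> pixels of row \<open>i\<close>; \<open>zs (\<kappa>, t)\<close> does the same for the rectangle spanned by \<open>(1, 1)\<close> and \<open>(i, j)\<close>.\<close>
  define zr where "zr j = N + 2 * h j" for j
  define zs where "zs j = N + 2 * h j + 1" for j
  have fresh: "zr j \<notin> \<X>" "zs j \<notin> \<X>" for j
    using N[of "zr j"] N[of "zs j"] by (auto simp: zr_def zs_def)
  have zr_inj: "zr j = zr j' \<longleftrightarrow> j = j'" "zs j = zs j' \<longleftrightarrow> j = j'" if "j \<in> J" "j' \<in> J" for j j'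
    using h that by (auto simp: zr_def zs_def inj_on_def)
  have zr_zs: "zr j \<noteq> zs j'" "zs j' \<noteq> zr j" for j j'
    unfolding zr_def zs_def by presburger+
  define Q where "Q = (zr ` J \<union> zs ` J) \<times> {1::nat}"
  have "finite Q" by (simp add: Q_def finJ)
  then obtain qs where qs: "set qs = Q" using finite_list by blast
  define S where "S = \<X> \<times> {1} \<union> Q"
  define row where "row \<kappa> t = (\<lambda>(p::picture) (V::so_val) a. [a] \<in> V (zr (\<kappa>, t)) (1::nat))" for \<kappa> t
  define rect where "rect \<kappa> t = (\<lambda>(p::picture) (V::so_val) a. [a] \<in> V (zs (\<kappa>, t)) (1::nat))" for \<kappa> t
  define C where "C p V a \<longleftrightarrow>
      (\<forall>\<kappa>\<in>K. \<forall>t\<in>{1..T}. row \<kappa> t p V a \<longleftrightarrow> shift (0, -1) (row \<kappa> t) p V a \<or>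
        (pixel_window b \<X> \<kappa> p V a \<and> (t = 1 \<or> shift (0, -1) (row \<kappa> (t - 1)) p V a))) \<and>
      (\<forall>\<kappa>\<in>K. \<forall>t\<in>{1..T}. rect \<kappa> t p V a \<longleftrightarrow> row \<kappa> t p V a \<or> shift (-1, 0) (rect \<kappa> t) p V a \<or>
        (\<exists>s\<in>{1..<t}. shift (-1, 0) (rect \<kappa> s) p V a \<and> row \<kappa> (t - s) p V a)) \<and>
      (\<not> shift (0, 1) (\<lambda>_ _ _. True) p V a \<and> \<not> shift (1, 0) (\<lambda>_ _ _. True) p V a \<longrightarrow>
        {j \<in> J. rect (fst j) (snd j) p V a} \<in> \<G>)" for p V a
  have row: "local_property b S (row \<kappa> t)" and rect: "local_property b S (rect \<kappa> t)"
    if "\<kappa> \<in> K" "t \<in> {1..T}" for \<kappa> t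
    unfolding row_def rect_def using that
    by (intro local_property_SO; force simp: S_def Q_def J_def)+
  have win: "local_property b S (pixel_window b \<X> \<kappa>)" for \<kappa>
    using local_property_window[of \<X> S b "fst \<kappa>" "snd \<kappa>"] fin unfolding pixel_window_def[abs_def]
    by (simp add: S_def)
  have C1: "local_property b S (\<lambda>p V a. row \<kappa> t p V a \<longleftrightarrow> shift (0, -1) (row \<kappa> t) p V a \<or>
        (pixel_window b \<X> \<kappa> p V a \<and> (t = 1 \<or> shift (0, -1) (row \<kappa> (t - 1)) p V a)))"
    if "\<kappa> \<in> K" "t \<in> {1..T}" for \<kappa> t
  proof -
    \<comment> \<open>For \<open>t = 1\<close> the index \<open>t - 1\<close> names no counter in
      \<open>Q\<close>, so the disjunction must be recognised as constantly true instead.\<close>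
    have "local_property b S (\<lambda>p V a. t = 1 \<or> shift (0, -1) (row \<kappa> (t - 1)) p V a)"
    proof (cases "t = 1")
      case True
      then show ?thesis by (simp add: local_property_const)
    next
      case False
      then have "t - 1 \<in> {1..T}" using that by auto
      then show ?thesis
        using that(1) by (intro local_property_disj local_property_const local_property_shift row)
    qed
    from local_property_iff[OF row[OF that] local_property_disj[OF local_property_shift[OF row[OF that]]
        local_property_conj[OF win this]]]
    show ?thesis .
  qed
  have C2: "local_property b S (\<lambda>p V a. rect \<kappa> t p V a \<longleftrightarrow> row \<kappa> t p V a \<or> shift (-1, 0) (rect \<kappa> t) p V a \<or>
        (\<exists>s\<in>{1..<t}. shift (-1, 0) (rect \<kappa> s) p V a \<and> row \<kappa> (t - s) p V a))"
    if "\<kappa> \<in> K" "t \<in> {1..T}" for \<kappa> t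
    using that
    by (intro local_property_iff local_property_disj local_property_bex local_property_conj
        local_property_shift row rect) auto
  have C3: "local_property b S (\<lambda>p V a. \<not> shift (0, 1) (\<lambda>_ _ _. True) p V a \<and> \<not> shift (1, 0) (\<lambda>_ _ _. True) p V a \<longrightarrow>
        {j \<in> J. rect (fst j) (snd j) p V a} \<in> \<G>)"
    by (intro local_property_imp local_property_conj local_property_not local_property_shift
        local_property_const local_property_boolean_combination finJ rect) (auto simp: J_def)
  have "local_property b S C"
    unfolding C_def[abs_def] by (intro local_property_conj local_property_ball C1 C2 C3 finK) auto
  then obtain \<chi> where \<chi>: "isBF \<chi>" "wf b \<chi>" "fv \<chi> \<subseteq> {0}" "fsv \<chi> \<subseteq> S"
    and sat_\<chi>: "\<And>p v V. v 0 \<in> pixels p \<Longrightarrow> sat p v V \<chi> = C p V (v 0)"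
    by (rule local_propertyE[where x = 0]) blast
  have C_iff: "(\<forall>a\<in>pixels (m, n, f). C (m, n, f) V' a) \<longleftrightarrow>
      (\<forall>\<kappa>\<in>K. \<forall>i\<in>{1..m}. \<forall>j\<in>{1..n}. \<forall>t\<in>{1..T}. row \<kappa> t (m, n, f) V' (i, j) \<longleftrightarrow>
         t \<le> row_count (pixel_window b \<X> \<kappa> (m, n, f) V) i j) \<and>
      (\<forall>\<kappa>\<in>K. \<forall>i\<in>{1..m}. \<forall>j\<in>{1..n}. \<forall>t\<in>{1..T}. rect \<kappa> t (m, n, f) V' (i, j) \<longleftrightarrow>
         t \<le> rect_count (pixel_window b \<X> \<kappa> (m, n, f) V) i j) \<and>
      {j \<in> J. snd j \<le> card {a \<in> pixels (m, n, f). pixel_window b \<X> (fst j) (m, n, f) V a}} \<in> \<G>"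
    (is "?L \<longleftrightarrow> ?row \<and> ?rect \<and> ?end")
    if agree: "agree_off (m, n, f) Q V V'" and mn: "1 \<le> m" "1 \<le> n" for m n f V V'
  proof -
    let ?p = "(m, n, f)"
    \<comment> \<open>Windows read only names in \<open>\<X>\<close>, so the guess cannot alter the
      occurrences it is meant to count.\<close>
    have "V X 1 = V' X 1" if "X \<in> \<X>" for X
    proof -
      have "(X, 1) \<notin> Q"
        using that fresh unfolding Q_def by blast
      with agree[unfolded agree_off_def, rule_format, of X 1] show ?thesis by simp
    qed
    then have "pixel_window b \<X> \<kappa> ?p V' = pixel_window b \<X> \<kappa> ?p V" for \<kappa>
      by (simp add: pixel_window_def[abs_def] label_cong[of \<X> V V'])
    moreover have "(m, n) \<in> pixels ?p"
      using mn by (simp add: pixels_def)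
    ultimately have win_eq: "pixel_window b \<X> \<kappa> ?p V' = pixel_window b \<X> \<kappa> ?p V" and corner: "(m, n) \<in> pixels ?p" for \<kappa>
      by blast+
    let ?P = "\<lambda>\<kappa> a. \<forall>t\<in>{1..T}. row \<kappa> t ?p V' a \<longleftrightarrow> shift (0, -1) (row \<kappa> t) ?p V' a \<or>
        (pixel_window b \<X> \<kappa> ?p V a \<and> (t = 1 \<or> shift (0, -1) (row \<kappa> (t - 1)) ?p V' a))"
    let ?P' = "\<lambda>\<kappa> i j. \<forall>t\<in>{1..T}. row \<kappa> t ?p V' (i, j) \<longleftrightarrow>
        (1 < j \<and> row \<kappa> t ?p V' (i, j - 1)) \<or> (pixel_window b \<X> \<kappa> ?p V (i, j) \<and>
          (t = 1 \<or> 1 < j \<and> row \<kappa> (t - 1) ?p V' (i, j - 1)))"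
    let ?R = "\<lambda>\<kappa> a. \<forall>t\<in>{1..T}. rect \<kappa> t ?p V' a \<longleftrightarrow> row \<kappa> t ?p V' a \<or> shift (-1, 0) (rect \<kappa> t) ?p V' a \<or>
        (\<exists>s\<in>{1..<t}. shift (-1, 0) (rect \<kappa> s) ?p V' a \<and> row \<kappa> (t - s) ?p V' a)"
    let ?R' = "\<lambda>\<kappa> i j. \<forall>t\<in>{1..T}. rect \<kappa> t ?p V' (i, j) \<longleftrightarrow>
        row \<kappa> t ?p V' (i, j) \<or> (1 < i \<and> rect \<kappa> t ?p V' (i - 1, j)) \<or>
        (\<exists>s\<in>{1..<t}. (1 < i \<and> rect \<kappa> s ?p V' (i - 1, j)) \<and> row \<kappa> (t - s) ?p V' (i, j))"
    let ?E = "\<lambda>a. {j \<in> J. rect (fst j) (snd j) ?p V' a} \<in> \<G>"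
    have "?L \<longleftrightarrow> (\<forall>a\<in>pixels ?p. \<forall>\<kappa>\<in>K. ?P \<kappa> a) \<and> (\<forall>a\<in>pixels ?p. \<forall>\<kappa>\<in>K. ?R \<kappa> a) \<and>
        (\<forall>a\<in>pixels ?p. a = (m, n) \<longrightarrow> ?E a)"
    proof (rule ball_conj3)
      fix a assume "a \<in> pixels ?p"
      from corner_iff[OF this]
      show "C ?p V' a \<longleftrightarrow> (\<forall>\<kappa>\<in>K. ?P \<kappa> a) \<and> (\<forall>\<kappa>\<in>K. ?R \<kappa> a) \<and> (a = (m, n) \<longrightarrow> ?E a)"
        unfolding C_def win_eq by (simp only:)
    qed
    also have "(\<forall>a\<in>pixels ?p. a = (m, n) \<longrightarrow> ?E a) \<longleftrightarrow> ?E (m, n)"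
      using corner by blast
    also have "(\<forall>a\<in>pixels ?p. \<forall>\<kappa>\<in>K. ?P \<kappa> a) \<longleftrightarrow> (\<forall>\<kappa>\<in>K. \<forall>i\<in>{1..m}. \<forall>j\<in>{1..n}. ?P' \<kappa> i j)"
      unfolding ball_pixels_rotate
      by (intro ball_cong refl) (simp only: shift_pixel_simps)
    also have "(\<forall>a\<in>pixels ?p. \<forall>\<kappa>\<in>K. ?R \<kappa> a) \<longleftrightarrow> (\<forall>\<kappa>\<in>K. \<forall>i\<in>{1..m}. \<forall>j\<in>{1..n}. ?R' \<kappa> i j)"
      unfolding ball_pixels_rotate
      by (intro ball_cong refl) (simp only: shift_pixel_simps)
    also have "(\<forall>\<kappa>\<in>K. \<forall>i\<in>{1..m}. \<forall>j\<in>{1..n}. ?P' \<kappa> i j) \<longleftrightarrow> ?row"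
      by (intro ball_cong refl row_recursion_iff)
    also have "?row \<and> (\<forall>\<kappa>\<in>K. \<forall>i\<in>{1..m}. \<forall>j\<in>{1..n}. ?R' \<kappa> i j) \<and> ?E (m, n) \<longleftrightarrow> ?row \<and> ?rect \<and> ?E (m, n)"
    proof -
      \<comment> \<open>The column rules express rectangle counts only when the row relations are
        correct, so they are rewritten under the conjunct \<open>?row\<close>.\<close>
      have "(\<forall>\<kappa>\<in>K. \<forall>i\<in>{1..m}. \<forall>j\<in>{1..n}. ?R' \<kappa> i j) \<longleftrightarrow> ?rect" if ?row
      proof (rule ball_cong[OF refl])
        fix \<kappa> assume "\<kappa> \<in> K"
        with that have "\<forall>i\<in>{1..m}. \<forall>j\<in>{1..n}. \<forall>t\<in>{1..T}. row \<kappa> t ?p V' (i, j) \<longleftrightarrow>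
          t \<le> row_count (pixel_window b \<X> \<kappa> ?p V) i j" by (rule bspec)
        then show "(\<forall>i\<in>{1..m}. \<forall>j\<in>{1..n}. ?R' \<kappa> i j) \<longleftrightarrow>
          (\<forall>i\<in>{1..m}. \<forall>j\<in>{1..n}. \<forall>t\<in>{1..T}. rect \<kappa> t ?p V' (i, j) \<longleftrightarrow>
             t \<le> rect_count (pixel_window b \<X> \<kappa> ?p V) i j)"
          by (rule rect_recursion_iff)
      qed
      then show ?thesis by (rule conj_cong[OF refl conj_cong[OF _ refl]])
    qed
    also have "\<dots> \<longleftrightarrow> ?row \<and> ?rect \<and> ?end"
    proof -
      \<comment> \<open>At the corner \<open>(m, n)\<close> the rectangle is the whole picture, so
        its counters form the global profile.\<close>
      have "{j \<in> J. rect (fst j) (snd j) ?p V' (m, n)} =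
          {j \<in> J. snd j \<le> card {a \<in> pixels ?p. pixel_window b \<X> (fst j) ?p V a}}" if ?rect
        using that mn by (auto simp: J_def rect_count_eq_card[of _ m n f])
      then show ?thesis by (intro conj_cong refl) (simp only:)
    qed
    finally show ?thesis .
  qed
  have "sat p v V \<psi> \<longleftrightarrow> sat p v V (block True qs (All1 0 \<chi>))" if p: "p \<in> PIC b" for p v V
  proof -
    \<comment> \<open>Both sides of the picture are at least 1, so the corner where the verdict is
      checked exists.\<close>
    obtain m n f where p_eq [simp]: "p = (m, n, f)" and mn: "1 \<le> m" "1 \<le> n"
      using p by (auto simp: PIC_def)
    let ?W = "\<lambda>\<kappa>. pixel_window b \<X> \<kappa> p V"
    \<comment> \<open>The intended counters. Restricting them to pixels meets the range condition of
      \<open>agree_off\<close>; injectivity of the names makes each of them carry exactly one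
      count.\<close>
    define V' where "V' X k = (if (X, k) \<in> Q then {[a] | a. a \<in> pixels p \<and>
        ((\<exists>j\<in>J. X = zr j \<and> snd j \<le> row_count (?W (fst j)) (fst a) (snd a)) \<or>
         (\<exists>j\<in>J. X = zs j \<and> snd j \<le> rect_count (?W (fst j)) (fst a) (snd a)))} else V X k)" for X k
    have agree: "agree_off p Q V V'"
      unfolding agree_off_def V'_def by (auto simp: Q_def)
    have "row \<kappa> t p V' a \<longleftrightarrow> t \<le> row_count (?W \<kappa>) (fst a) (snd a)"
      "rect \<kappa> t p V' a \<longleftrightarrow> t \<le> rect_count (?W \<kappa>) (fst a) (snd a)"
      if "\<kappa> \<in> K" "t \<in> {1..T}" "a \<in> pixels p" for \<kappa> t a
    proof -
      obtain i i' where [simp]: "a = (i, i')" by (cases a)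
      have j: "(\<kappa>, t) \<in> J" using that by (simp add: J_def)
      then have "(zr (\<kappa>, t), 1) \<in> Q" "(zs (\<kappa>, t), 1) \<in> Q" by (simp_all add: Q_def)
      then show "row \<kappa> t p V' a \<longleftrightarrow> t \<le> row_count (?W \<kappa>) (fst a) (snd a)"
        "rect \<kappa> t p V' a \<longleftrightarrow> t \<le> rect_count (?W \<kappa>) (fst a) (snd a)"
        unfolding row_def rect_def V'_def using j that(3) by (auto simp: zr_zs zr_inj)
    qed
    then have correct: "(\<forall>\<kappa>\<in>K. \<forall>i\<in>{1..m}. \<forall>j\<in>{1..n}. \<forall>t\<in>{1..T}. row \<kappa> t p V' (i, j) \<longleftrightarrow>
         t \<le> row_count (?W \<kappa>) i j)"
      "(\<forall>\<kappa>\<in>K. \<forall>i\<in>{1..m}. \<forall>j\<in>{1..n}. \<forall>t\<in>{1..T}. rect \<kappa> t p V' (i, j) \<longleftrightarrow>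
         t \<le> rect_count (?W \<kappa>) i j)"
      by (auto simp: pixels_def)
    have "sat p v V (block True qs (All1 0 \<chi>)) \<longleftrightarrow> (\<exists>V'. agree_off p Q V V' \<and> (\<forall>a\<in>pixels p. C p V' a))"
      unfolding sat_block qs by (simp add: sat_\<chi>)
    \<comment> \<open>From left to right any guess passing the rules reveals the true profile; from
      right to left the intended counters are the witness.\<close>
    also have "\<dots> \<longleftrightarrow> {j \<in> J. snd j \<le> card {a \<in> pixels p. ?W (fst j) a}} \<in> \<G>"
      using C_iff[OF _ mn, of f V] agree correct unfolding p_eq by blast
    also have "\<dots> \<longleftrightarrow> sat p v V \<psi>"
      unfolding J_def thr[of p v V] ..
    finally show ?thesis by simp
  qed
  moreover have "isLFO (All1 0 \<chi>)" using \<chi>(1) by (auto simp: isLFO_def)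
  ultimately show thesis
    using \<chi> qs fsv by (intro that[of "All1 0 \<chi>" qs]) (auto simp: S_def)
qed

section \<open>From local relations to unary relations\<close>

text \<open>The counterpart of \<open>local_property\<close> for several free variables and
  unrestricted quantifiers, which are allowed here since the target matrix is first-order.\<close>

definition FO_property :: "nat \<Rightarrow> nat set \<Rightarrow> (nat \<times> nat) set \<Rightarrow> (picture \<Rightarrow> (nat \<Rightarrow> pixel) \<Rightarrow> so_val \<Rightarrow> bool) \<Rightarrow> bool" where
  "FO_property b F S \<Pi> \<longleftrightarrow> (\<exists>\<psi>. isFO \<psi> \<and> wf b \<psi> \<and> fv \<psi> \<subseteq> F \<and> fsv \<psi> \<subseteq> S \<and>
     (\<forall>p v V. (\<forall>x\<in>F. v x \<in> pixels p) \<longrightarrow> sat p v V \<psi> = \<Pi> p v V))"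

lemma FO_propertyI:
  assumes "isFO \<psi>" "wf b \<psi>" "fv \<psi> \<subseteq> F" "fsv \<psi> \<subseteq> S"
    "\<And>p v V. (\<And>x. x \<in> F \<Longrightarrow> v x \<in> pixels p) \<Longrightarrow> sat p v V \<psi> = \<Pi> p v V"
  shows "FO_property b F S \<Pi>"
  unfolding FO_property_def using assms by blast

lemma FO_propertyE:
  assumes "FO_property b F S \<Pi>"
  obtains \<psi> where "isFO \<psi>" "wf b \<psi>" "fv \<psi> \<subseteq> F" "fsv \<psi> \<subseteq> S"
    "\<And>p v V. (\<And>x. x \<in> F \<Longrightarrow> v x \<in> pixels p) \<Longrightarrow> sat p v V \<psi> = \<Pi> p v V"
  using assms unfolding FO_property_def by blast

lemma FO_property_mono:
  assumes "FO_property b F S \<Pi>" "F \<subseteq> F'" "S \<subseteq> S'"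
  shows "FO_property b F' S' \<Pi>"
proof -
  from assms(1) obtain \<psi> where \<psi>: "isFO \<psi>" "wf b \<psi>" "fv \<psi> \<subseteq> F" "fsv \<psi> \<subseteq> S"
    and sat: "\<And>p v V. (\<And>x. x \<in> F \<Longrightarrow> v x \<in> pixels p) \<Longrightarrow> sat p v V \<psi> = \<Pi> p v V"
    by (rule FO_propertyE) blast
  show ?thesis
  proof (rule FO_propertyI)
    show "isFO \<psi>" "wf b \<psi>" "fv \<psi> \<subseteq> F'" "fsv \<psi> \<subseteq> S'"
      using \<psi> assms(2,3) by auto
    show "sat p v V \<psi> = \<Pi> p v V" if "\<And>x. x \<in> F' \<Longrightarrow> v x \<in> pixels p" for p v V
      using that assms(2) by (intro sat) auto
  qed
qed

lemma FO_property_False: "FO_property b F S (\<lambda>p v V. False)"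
  \<comment> \<open>A closed formula is needed, as \<open>F\<close> may be empty.\<close>
  by (rule FO_propertyI[of "Ex1 0 (Neg (EqAt 0 0))"]) (simp_all add: isFO_def)

lemma FO_property_not:
  assumes "FO_property b F S \<Pi>"
  shows "FO_property b F S (\<lambda>p v V. \<not> \<Pi> p v V)"
proof -
  from assms obtain \<psi> where \<psi>: "isFO \<psi>" "wf b \<psi>" "fv \<psi> \<subseteq> F" "fsv \<psi> \<subseteq> S"
    and sat: "\<And>p v V. (\<And>x. x \<in> F \<Longrightarrow> v x \<in> pixels p) \<Longrightarrow> sat p v V \<psi> = \<Pi> p v V"
    by (rule FO_propertyE) blast
  show ?thesis
    by (rule FO_propertyI[of "Neg \<psi>"]) (use \<psi> sat in \<open>simp_all add: isFO_def\<close>)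
qed

lemma FO_property_disj:
  assumes "FO_property b F S \<Pi>" "FO_property b F S \<Pi>'"
  shows "FO_property b F S (\<lambda>p v V. \<Pi> p v V \<or> \<Pi>' p v V)"
proof -
  from assms(1) obtain \<psi> where \<psi>: "isFO \<psi>" "wf b \<psi>" "fv \<psi> \<subseteq> F" "fsv \<psi> \<subseteq> S"
    and sat: "\<And>p v V. (\<And>x. x \<in> F \<Longrightarrow> v x \<in> pixels p) \<Longrightarrow> sat p v V \<psi> = \<Pi> p v V"
    by (rule FO_propertyE) blast
  from assms(2) obtain \<psi>' where \<psi>': "isFO \<psi>'" "wf b \<psi>'" "fv \<psi>' \<subseteq> F" "fsv \<psi>' \<subseteq> S"
    and sat': "\<And>p v V. (\<And>x. x \<in> F \<Longrightarrow> v x \<in> pixels p) \<Longrightarrow> sat p v V \<psi>' = \<Pi>' p v V"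
    by (rule FO_propertyE) blast
  show ?thesis
    by (rule FO_propertyI[of "Disj \<psi> \<psi>'"]) (use \<psi> \<psi>' sat sat' in \<open>simp_all add: isFO_def\<close>)
qed

lemma FO_property_conj:
  assumes "FO_property b F S \<Pi>" "FO_property b F S \<Pi>'"
  shows "FO_property b F S (\<lambda>p v V. \<Pi> p v V \<and> \<Pi>' p v V)"
proof -
  have "FO_property b F S (\<lambda>p v V. \<not> (\<not> \<Pi> p v V \<or> \<not> \<Pi>' p v V))"
    using assms by (intro FO_property_not FO_property_disj)
  then show ?thesis by simp
qed

lemma FO_property_bex:
  assumes "finite I" "\<And>i. i \<in> I \<Longrightarrow> FO_property b F S (\<Pi> i)"
  shows "FO_property b F S (\<lambda>p v V. \<exists>i\<in>I. \<Pi> i p v V)"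
  using assms
proof (induction I rule: finite_induct)
  case empty
  then show ?case by (simp add: FO_property_False)
next
  case (insert i I)
  then have "FO_property b F S (\<lambda>p v V. \<Pi> i p v V \<or> (\<exists>i\<in>I. \<Pi> i p v V))"
    by (intro FO_property_disj) auto
  then show ?case by simp
qed

lemma FO_property_ball:
  assumes "finite I" "\<And>i. i \<in> I \<Longrightarrow> FO_property b F S (\<Pi> i)"
  shows "FO_property b F S (\<lambda>p v V. \<forall>i\<in>I. \<Pi> i p v V)"
proof -
  have "FO_property b F S (\<lambda>p v V. \<not> (\<exists>i\<in>I. \<not> \<Pi> i p v V))"
    using assms by (intro FO_property_not FO_property_bex)
  then show ?thesis by simp
qed

section \<open>First-order definability of fixed offsets\<close>

definition FO_offset :: "nat \<Rightarrow> offset \<Rightarrow> bool" where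
  "FO_offset b d \<longleftrightarrow> (\<forall>x y. FO_property b {x, y} {} (\<lambda>p v V. pos (v y) = pos (v x) + d))"

lemma FO_offset_zero: "FO_offset b 0"
  unfolding FO_offset_def
proof (intro allI)
  show "FO_property b {x, y} {} (\<lambda>p v V. pos (v y) = pos (v x) + 0)" for x y
    by (rule FO_propertyI[of "EqAt y x"]) (auto simp: isFO_def)
qed

lemma FO_offset_uminus:
  assumes "FO_offset b d"
  shows "FO_offset b (- d)"
  unfolding FO_offset_def
proof (intro allI)
  fix x y
  have "FO_property b {y, x} {} (\<lambda>p v V. pos (v x) = pos (v y) + d)"
    using assms by (simp add: FO_offset_def)
  moreover have "pos (v x) = pos (v y) + d \<longleftrightarrow> pos (v y) = pos (v x) + - d" for v :: "nat \<Rightarrow> pixel"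
    by (auto simp: algebra_simps)
  ultimately show "FO_property b {x, y} {} (\<lambda>p v V. pos (v y) = pos (v x) + - d)"
    by (simp add: insert_commute)
qed

lemma FO_offset_unit:
  assumes "e \<in> unit_offsets"
  shows "FO_offset b e"
  unfolding FO_offset_def
proof (intro allI)
  fix x y
  obtain \<rho> where \<rho>: "isBF \<rho>" "wf b \<rho>" "fv \<rho> = {x, y}" "fsv \<rho> = {}"
    "\<And>p v V. v x \<in> pixels p \<Longrightarrow> v y \<in> pixels p \<Longrightarrow> sat p v V \<rho> \<longleftrightarrow> pos (v y) = pos (v x) + e"
    by (rule unit_offset_formula[OF assms, of b x y]) blast
  have "isBF \<psi> \<Longrightarrow> noSO \<psi>" for \<psi>
    by (induction \<psi>) auto
  then show "FO_property b {x, y} {} (\<lambda>p v V. pos (v y) = pos (v x) + e)"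
    by (intro FO_propertyI[of \<rho>]) (simp_all add: \<rho> isFO_def)
qed

lemma FO_offset_add:
  assumes "FO_offset b e" "FO_offset b d"
    and sgn: "0 \<le> fst e \<and> 0 \<le> fst d \<or> fst e \<le> 0 \<and> fst d \<le> 0"
      "0 \<le> snd e \<and> 0 \<le> snd d \<or> snd e \<le> 0 \<and> snd d \<le> 0"
  shows "FO_offset b (e + d)"
  unfolding FO_offset_def
proof (intro allI)
  fix x y
  define z where "z = Suc (x + y)"
  have z: "z \<noteq> x" "z \<noteq> y"
    by (simp_all add: z_def)
  have "FO_property b {x, z} {} (\<lambda>p v V. pos (v z) = pos (v x) + e)"
    using assms(1) by (simp add: FO_offset_def)
  then obtain \<psi> where \<psi>: "isFO \<psi>" "wf b \<psi>" "fv \<psi> \<subseteq> {x, z}" "fsv \<psi> \<subseteq> {}"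
    and sat_\<psi>: "\<And>p v V. (\<And>w. w \<in> {x, z} \<Longrightarrow> v w \<in> pixels p) \<Longrightarrow>
      sat p v V \<psi> \<longleftrightarrow> pos (v z) = pos (v x) + e"
    by (rule FO_propertyE) blast
  have "FO_property b {z, y} {} (\<lambda>p v V. pos (v y) = pos (v z) + d)"
    using assms(2) by (simp add: FO_offset_def)
  then obtain \<chi> where \<chi>: "isFO \<chi>" "wf b \<chi>" "fv \<chi> \<subseteq> {z, y}" "fsv \<chi> \<subseteq> {}"
    and sat_\<chi>: "\<And>p v V. (\<And>w. w \<in> {z, y} \<Longrightarrow> v w \<in> pixels p) \<Longrightarrow>
      sat p v V \<chi> \<longleftrightarrow> pos (v y) = pos (v z) + d"
    by (rule FO_propertyE) blast
  show "FO_property b {x, y} {} (\<lambda>p v V. pos (v y) = pos (v x) + (e + d))"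
  proof (rule FO_propertyI[of "Ex1 z (Conj \<psi> \<chi>)"])
    fix p v V assume v: "\<And>w. w \<in> {x, y} \<Longrightarrow> v w \<in> pixels p"
    have "sat p v V (Ex1 z (Conj \<psi> \<chi>)) \<longleftrightarrow>
        (\<exists>c\<in>pixels p. pos c = pos (v x) + e \<and> pos (v y) = pos c + d)"
      unfolding sat.simps Conj_simps
    proof (intro bex_cong refl)
      fix c assume "c \<in> pixels p"
      then have "sat p (v(z := c)) V \<psi> \<longleftrightarrow> pos ((v(z := c)) z) = pos ((v(z := c)) x) + e"
        "sat p (v(z := c)) V \<chi> \<longleftrightarrow> pos ((v(z := c)) y) = pos ((v(z := c)) z) + d"
        using v z by (intro sat_\<psi> sat_\<chi>; auto)+
      with z show "sat p (v(z := c)) V \<psi> \<and> sat p (v(z := c)) V \<chi> \<longleftrightarrow>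
          pos c = pos (v x) + e \<and> pos (v y) = pos c + d"
        by simp
    qed
    also have "\<dots> \<longleftrightarrow> pos (v y) = pos (v x) + (e + d)"
    proof
      assume *: "pos (v y) = pos (v x) + (e + d)"
      have "pos (v x) \<in> grid p" "pos (v x) + (e + d) \<in> grid p"
        using v by (simp_all flip: *)
      from grid_monotone_path[OF this sgn] obtain c where "c \<in> pixels p" "pos (v x) + e = pos c"
        unfolding grid_def by blast
      with * show "\<exists>c\<in>pixels p. pos c = pos (v x) + e \<and> pos (v y) = pos c + d"
        by (intro bexI[of _ c]) (simp_all add: add.assoc flip: \<open>_ = pos c\<close>)
    qed (auto simp: add.assoc)
    finally show "sat p v V (Ex1 z (Conj \<psi> \<chi>)) \<longleftrightarrow> pos (v y) = pos (v x) + (e + d)" .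
  qed (use \<psi> \<chi> in \<open>auto simp: isFO_def\<close>)
qed

text \<open>The same L-shaped walk as for bounded formulas. With both endpoints free, swapping them
  handles negative legs.\<close>

lemma FO_offset: "FO_offset b d"
proof -
  have down: "FO_offset b (int n, 0)" for n
  proof (induction n)
    case (Suc n)
    from FO_offset_add[OF FO_offset_unit[of "(1, 0)"] Suc] show ?case
      by (simp add: unit_offsets_def add.commute)
  qed (use FO_offset_zero in \<open>simp add: zero_prod_def\<close>)
  have right: "FO_offset b (0, int n)" for n
  proof (induction n)
    case (Suc n)
    from FO_offset_add[OF FO_offset_unit[of "(0, 1)"] Suc] show ?case
      by (simp add: unit_offsets_def add.commute)
  qed (use FO_offset_zero in \<open>simp add: zero_prod_def\<close>)
  have vert: "FO_offset b (i, 0)" for i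
    using down FO_offset_uminus[OF down] by (cases i rule: int_cases2) simp_all
  have horiz: "FO_offset b (0, j)" for j
    using right FO_offset_uminus[OF right] by (cases j rule: int_cases2) simp_all
  have "FO_offset b ((fst d, 0) + (0, snd d))"
    by (rule FO_offset_add[OF vert horiz]) auto
  then show ?thesis by simp
qed

text \<open>Each shape \<open>ds\<close> of a tuple gets its own unary relation, holding the first
  pixels of the tuples of that shape. Countability supplies injective names, and the arity is
  recovered as \<open>length ds\<close>.\<close>

definition code :: "nat \<Rightarrow> offset list \<Rightarrow> nat" where
  "code X ds = to_nat (X, ds)"

lemma code_eq_iff [simp]: "code X ds = code Y es \<longleftrightarrow> X = Y \<and> ds = es"
  by (simp add: code_def)

definition offsets :: "pixel list \<Rightarrow> offset list" where
  "offsets as = map (\<lambda>a. pos a - pos (hd as)) as"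

lemma length_offsets [simp]: "length (offsets as) = length as"
  by (simp add: offsets_def)

lemma offsets_Nil_iff [simp]: "offsets as = [] \<longleftrightarrow> as = []"
  by (simp add: offsets_def)

lemma offsets_eqD:
  assumes "offsets as = offsets cs" "hd as = hd cs"
  shows "as = cs"
proof (rule nth_equalityI)
  show "length as = length cs"
    using arg_cong[OF assms(1), of length] by simp
  fix i assume "i < length as"
  with \<open>length as = length cs\<close> arg_cong[OF assms(1), of "\<lambda>ds. ds ! i"] assms(2)
  show "as ! i = cs ! i" by (simp add: offsets_def)
qed

definition codes :: "nat \<Rightarrow> (nat \<times> nat) set \<Rightarrow> (nat \<times> nat) set" where
  "codes r Q = {(code X ds, 1) | X ds. (X, length ds) \<in> Q \<and> set ds \<subseteq> box r}"

lemma codes_mono: "Q \<subseteq> Q' \<Longrightarrow> codes r Q \<subseteq> codes r Q'"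
  by (auto simp: codes_def)

lemma code_in_codes_iff [simp]:
  "(code X ds, k) \<in> codes r Q \<longleftrightarrow> k = 1 \<and> (X, length ds) \<in> Q \<and> set ds \<subseteq> box r"
  by (auto simp: codes_def)

lemma finite_codes:
  assumes "finite Q"
  shows "finite (codes r Q)"
proof -
  have "codes r Q \<subseteq> (\<Union>(X, k)\<in>Q. (\<lambda>ds. (code X ds, 1)) ` {ds. set ds \<subseteq> box r \<and> length ds = k})"
    by (fastforce simp: codes_def)
  moreover have "finite (\<Union>(X, k)\<in>Q. (\<lambda>ds. (code X ds, 1::nat)) ` {ds. set ds \<subseteq> box r \<and> length ds = k})"
    using assms by (auto intro!: finite_lists_length_eq)
  ultimately show ?thesis by (rule finite_subset)
qed

text \<open>A tuple is given by its first pixel and its list of offsets. A 0-ary relation has no first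
  pixel: it is coded by a unary relation that is nonempty iff the 0-ary relation holds.\<close>

definition decode :: "picture \<Rightarrow> so_val \<Rightarrow> nat \<Rightarrow> pixel list \<Rightarrow> bool" where
  "decode p W X as \<longleftrightarrow>
    (if as = [] then \<exists>a\<in>pixels p. [a] \<in> W (code X []) 1 else [hd as] \<in> W (code X (offsets as)) 1)"

text \<open>Tuples spreading beyond \<open>r\<close> are left unrelated on purpose: finitely many
  names cannot cover them in all pictures, and formulas of depth up to \<open>r\<close> never test
  them from a single pixel.\<close>

definition coded :: "nat \<Rightarrow> picture \<Rightarrow> so_val \<Rightarrow> so_val \<Rightarrow> bool" where
  "coded r p V W \<longleftrightarrow> (\<forall>X as. set as \<subseteq> pixels p \<longrightarrow> set (offsets as) \<subseteq> box r \<longrightarrow>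
     (as \<in> V X (length as) \<longleftrightarrow> decode p W X as))"

lemma decode_cong:
  assumes "W' (code X (offsets as)) 1 = W (code X (offsets as)) 1"
  shows "decode p W' X as = decode p W X as"
  using assms by (cases as) (auto simp: decode_def offsets_def)

text \<open>A true 0-ary relation is coded by all pixels, which is nonempty only because the picture
  is.\<close>

lemma coded_forth:
  assumes cod: "coded r p V W" and agree: "agree_off p Q V V'" and ne: "pixels p \<noteq> {}"
  shows "\<exists>W'. agree_off p (codes r Q) W W' \<and> coded r p V' W'"
proof -
  define W' where "W' n k = (if (n, k) \<in> codes r Q then {[a] | a. a \<in> pixels p \<and>
      (\<exists>X as. n = code X (offsets as) \<and> set as \<subseteq> pixels p \<and> as \<in> V' X (length as) \<and>
        (as \<noteq> [] \<longrightarrow> hd as = a))} else W n k)" for n k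
  have "agree_off p (codes r Q) W W'"
    unfolding agree_off_def W'_def by (auto simp: codes_def)
  moreover have "coded r p V' W'"
    unfolding coded_def
  proof (intro allI impI)
    fix X as assume as: "set as \<subseteq> pixels p" "set (offsets as) \<subseteq> box r"
    show "as \<in> V' X (length as) \<longleftrightarrow> decode p W' X as"
    proof (cases "(X, length as) \<in> Q")
      case True
      with as have W': "W' (code X (offsets as)) 1 = {[a] | a. a \<in> pixels p \<and>
          (\<exists>cs. offsets as = offsets cs \<and> set cs \<subseteq> pixels p \<and> cs \<in> V' X (length cs) \<and>
          (cs \<noteq> [] \<longrightarrow> hd cs = a))}"
        unfolding W'_def by auto
      show ?thesis
      proof (cases "as = []")
        case True
        have "W' (code X []) 1 = {[a] | a. a \<in> pixels p \<and> [] \<in> V' X 0}"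
          using W' True by (auto simp: offsets_def)
        then show ?thesis
          using True ne by (auto simp: decode_def)
      next
        case False
        have "offsets as = offsets cs \<and> set cs \<subseteq> pixels p \<and> cs \<in> V' X (length cs) \<and>
            (cs \<noteq> [] \<longrightarrow> hd cs = hd as) \<longleftrightarrow> cs = as \<and> as \<in> V' X (length as)" for cs
          using False as(1) offsets_eqD[of as cs] by (metis offsets_Nil_iff)
        moreover have "[hd as] \<in> W' (code X (offsets as)) 1 \<longleftrightarrow> hd as \<in> pixels p \<and>
            (\<exists>cs. offsets as = offsets cs \<and> set cs \<subseteq> pixels p \<and> cs \<in> V' X (length cs) \<and>
            (cs \<noteq> [] \<longrightarrow> hd cs = hd as))"
          unfolding W' by blast
        ultimately have "[hd as] \<in> W' (code X (offsets as)) 1 \<longleftrightarrow> hd as \<in> pixels p \<and> as \<in> V' X (length as)"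
          by simp
        moreover have "hd as \<in> pixels p" using False as(1) by auto
        ultimately show ?thesis using False by (simp add: decode_def)
      qed
    next
      \<comment> \<open>Neither the relation nor its codes are quantified in this block, so the old
        agreement carries over.\<close>
      case False
      then have "V' X (length as) = V X (length as)"
        using agree[unfolded agree_off_def, rule_format, of X "length as"] by simp
      moreover have "decode p W' X as = decode p W X as"
        using False by (intro decode_cong) (simp add: W'_def)
      ultimately show ?thesis
        using cod as by (simp add: coded_def)
    qed
  qed
  ultimately show ?thesis by blast
qed

lemma coded_back:
  assumes cod: "coded r p V W" and agree: "agree_off p (codes r Q) W W'"
  shows "\<exists>V'. agree_off p Q V V' \<and> coded r p V' W'"
proof -
  \<comment> \<open>Reading the codes back fixes widely spread tuples as well, in a way that
    \<open>coded\<close> does not constrain.\<close>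
  define V' where "V' X k = (if (X, k) \<in> Q then {as. length as = k \<and> set as \<subseteq> pixels p \<and> decode p W' X as}
      else V X k)" for X k
  have "agree_off p Q V V'"
    by (auto simp: agree_off_def V'_def)
  moreover have "coded r p V' W'"
    unfolding coded_def
  proof (intro allI impI)
    fix X as assume as: "set as \<subseteq> pixels p" "set (offsets as) \<subseteq> box r"
    show "as \<in> V' X (length as) \<longleftrightarrow> decode p W' X as"
    proof (cases "(X, length as) \<in> Q")
      case False
      then have "W' (code X (offsets as)) 1 = W (code X (offsets as)) 1"
        using agree[unfolded agree_off_def, rule_format, of "code X (offsets as)" 1] by simp
      then have "decode p W' X as = decode p W X as"
        by (rule decode_cong)
      then show ?thesis
        using False cod as by (simp add: V'_def coded_def)
    qed (use as in \<open>simp add: V'_def\<close>)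
  qed
  ultimately show ?thesis by blast
qed

text \<open>Only bounded quantifiers count: this is the number of steps a bounded formula can walk
  away from its free variables.\<close>

fun depth :: "form \<Rightarrow> nat" where
  "depth (Neg \<phi>) = depth \<phi>"
| "depth (Disj \<phi> \<psi>) = max (depth \<phi>) (depth \<psi>)"
| "depth (Ex1 x \<phi>) = depth \<phi>"
| "depth (BEx y x \<phi>) = Suc (depth \<phi>)"
| "depth (SEx X k \<phi>) = depth \<phi>"
| "depth _ = 0"

lemma depth_block [simp]: "depth (block ex qs \<psi>) = depth \<psi>"
  by (induction qs) (auto simp: SAll_def)

text \<open>Within radius \<open>r\<close> there are finitely many shapes. A disjunction over them
  tests with offset formulas which one the tuple has and asks its unary relation about the first
  pixel.\<close>

lemma SO_atom_to_FO:
  "\<exists>\<psi>. isFO \<psi> \<and> wf b \<psi> \<and> fv \<psi> \<subseteq> set xs \<and> fsv \<psi> \<subseteq> codes r {(X, length xs)} \<and>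
    (\<forall>p v W. v ` set xs \<subseteq> pixels p \<longrightarrow> set (offsets (map v xs)) \<subseteq> box r \<longrightarrow>
      sat p v W \<psi> = decode p W X (map v xs))"
proof (cases "xs = []")
  case True
  then show ?thesis
    by (intro exI[of _ "Ex1 0 (SOAt (code X []) [0])"]) (simp add: isFO_def decode_def)
next
  case False
  let ?x = "hd xs" and ?D = "{ds. set ds \<subseteq> box r \<and> length ds = length xs}"
  define \<Pi> where "\<Pi> = (\<lambda>(p :: picture) (v :: nat \<Rightarrow> pixel) (W :: so_val). \<exists>ds\<in>?D. [v ?x] \<in> W (code X ds) 1 \<and>
    (\<forall>i\<in>{..<length xs}. pos (v (xs ! i)) = pos (v ?x) + ds ! i))"
  have "FO_property b (set xs) (codes r {(X, length xs)}) \<Pi>"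
    unfolding \<Pi>_def
  proof (intro FO_property_bex FO_property_conj FO_property_ball)
    show "finite ?D" by (rule finite_lists_length_eq) simp
    show "FO_property b (set xs) (codes r {(X, length xs)}) (\<lambda>p v W. [v ?x] \<in> W (code X ds) 1)" if "ds \<in> ?D" for ds
      by (rule FO_propertyI[of "SOAt (code X ds) [?x]"]) (use that False in \<open>auto simp: isFO_def\<close>)
    show "FO_property b (set xs) (codes r {(X, length xs)}) (\<lambda>p v W. pos (v (xs ! i)) = pos (v ?x) + ds ! i)"
      if "i \<in> {..<length xs}" for i ds
    proof (rule FO_property_mono)
      show "FO_property b {?x, xs ! i} {} (\<lambda>p v W. pos (v (xs ! i)) = pos (v ?x) + ds ! i)"
        using FO_offset[of b "ds ! i"] by (simp add: FO_offset_def)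
    qed (use that False in auto)
  qed simp
  then obtain \<psi> where \<psi>: "isFO \<psi>" "wf b \<psi>" "fv \<psi> \<subseteq> set xs" "fsv \<psi> \<subseteq> codes r {(X, length xs)}"
    and sat: "\<And>p v W. (\<And>x. x \<in> set xs \<Longrightarrow> v x \<in> pixels p) \<Longrightarrow> sat p v W \<psi> = \<Pi> p v W"
    by (rule FO_propertyE) blast
  have "\<Pi> p v W \<longleftrightarrow> decode p W X (map v xs)" if "set (offsets (map v xs)) \<subseteq> box r" for p v W
  proof -
    have nth: "offsets (map v xs) ! i = pos (v (xs ! i)) - pos (v ?x)" if "i < length xs" for i
      using that False by (simp add: offsets_def hd_map)
    have "(\<forall>i\<in>{..<length xs}. pos (v (xs ! i)) = pos (v ?x) + ds ! i) \<longleftrightarrow> ds = offsets (map v xs)"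
      if "length ds = length xs" for ds
    proof -
      have "pos (v (xs ! i)) = pos (v ?x) + ds ! i \<longleftrightarrow> ds ! i = offsets (map v xs) ! i" if "i < length xs" for i
        unfolding nth[OF that] by (auto simp: algebra_simps)
      moreover have "ds = offsets (map v xs) \<longleftrightarrow> (\<forall>i<length xs. ds ! i = offsets (map v xs) ! i)"
        using that by (simp add: list_eq_iff_nth_eq)
      ultimately show ?thesis by blast
    qed
    then have "\<Pi> p v W \<longleftrightarrow> (\<exists>ds\<in>?D. [v ?x] \<in> W (code X ds) 1 \<and> ds = offsets (map v xs))"
      unfolding \<Pi>_def by (intro bex_cong) auto
    also have "\<dots> \<longleftrightarrow> decode p W X (map v xs)"
      using False that by (auto simp: decode_def hd_map)
    finally show ?thesis .
  qed
  with \<psi> sat show ?thesis by (intro exI[of _ \<psi>]) (simp add: image_subset_iff)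
qed

text \<open>\<open>n\<close> bounds the spread of the free variables. A bounded quantifier raises it
  by one and uses up one unit of depth, so \<open>n + depth \<psi>\<close> stays below
  \<open>r\<close> down to the atoms. The translation itself is independent of
  \<open>n\<close>.\<close>

lemma BF_to_FO:
  assumes "isBF \<psi>" "wf b \<psi>"
  shows "\<exists>\<psi>'. isFO \<psi>' \<and> wf b \<psi>' \<and> fv \<psi>' \<subseteq> fv \<psi> \<and> fsv \<psi>' \<subseteq> codes r (fsv \<psi>) \<and>
    (\<forall>p v V W n. coded r p V W \<longrightarrow> (\<forall>x\<in>fv \<psi>. v x \<in> pixels p) \<longrightarrow>
      (\<forall>x\<in>fv \<psi>. \<forall>y\<in>fv \<psi>. pos (v y) - pos (v x) \<in> box n) \<longrightarrow> n + depth \<psi> \<le> r \<longrightarrow>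
      sat p v V \<psi> = sat p v W \<psi>')"
  using assms
proof (induction \<psi>)
  case (UAt k x)
  then show ?case by (intro exI[of _ "UAt k x"]) (simp add: isFO_def)
next
  case (RAt i x y)
  then show ?case by (intro exI[of _ "RAt i x y"]) (simp add: isFO_def)
next
  case (EqAt x y)
  then show ?case by (intro exI[of _ "EqAt x y"]) (simp add: isFO_def)
next
  case (SOAt X xs)
  from SO_atom_to_FO[of b xs r X] obtain \<psi>' where
    \<psi>': "isFO \<psi>'" "wf b \<psi>'" "fv \<psi>' \<subseteq> set xs" "fsv \<psi>' \<subseteq> codes r {(X, length xs)}"
    and sat: "\<And>p v W. v ` set xs \<subseteq> pixels p \<Longrightarrow> set (offsets (map v xs)) \<subseteq> box r \<Longrightarrow>
      sat p v W \<psi>' = decode p W X (map v xs)" by blast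
  have "sat p v V (SOAt X xs) = sat p v W \<psi>'"
    if "coded r p V W" "\<forall>x\<in>set xs. v x \<in> pixels p" "\<forall>x\<in>set xs. \<forall>y\<in>set xs. pos (v y) - pos (v x) \<in> box n" "n \<le> r"
    for p v V W n
  proof -
    have "v ` set xs \<subseteq> pixels p" using that(2) by auto
    moreover have "set (offsets (map v xs)) \<subseteq> box r"
    proof
      fix d assume d: "d \<in> set (offsets (map v xs))"
      then have "xs \<noteq> []" by (auto simp: offsets_def)
      then have "hd xs \<in> set xs" "hd (map v xs) = v (hd xs)" by (simp_all add: hd_map)
      moreover from this d obtain x where "x \<in> set xs" "d = pos (v x) - pos (v (hd xs))"
        by (auto simp: offsets_def)
      ultimately have "d \<in> box n" using that(3) by blast
      then show "d \<in> box r" using that(4) by (rule box_mono)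
    qed
    ultimately show ?thesis
      using that(1)[unfolded coded_def, rule_format, of "map v xs" X] sat[of v p W] by simp
  qed
  with \<psi>' show ?case by (intro exI[of _ \<psi>']) auto
next
  case (Neg \<psi>)
  then obtain \<psi>' where "isFO \<psi>'" "wf b \<psi>'" "fv \<psi>' \<subseteq> fv \<psi>" "fsv \<psi>' \<subseteq> codes r (fsv \<psi>)"
    "\<forall>p v V W n. coded r p V W \<longrightarrow> (\<forall>x\<in>fv \<psi>. v x \<in> pixels p) \<longrightarrow>
      (\<forall>x\<in>fv \<psi>. \<forall>y\<in>fv \<psi>. pos (v y) - pos (v x) \<in> box n) \<longrightarrow> n + depth \<psi> \<le> r \<longrightarrow>
      sat p v V \<psi> = sat p v W \<psi>'" by auto
  then show ?case by (intro exI[of _ "Neg \<psi>'"]) (simp add: isFO_def)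
next
  case (Disj \<psi> \<chi>)
  then obtain \<psi>' where \<psi>': "isFO \<psi>'" "wf b \<psi>'" "fv \<psi>' \<subseteq> fv \<psi>" "fsv \<psi>' \<subseteq> codes r (fsv \<psi>)"
    "\<forall>p v V W n. coded r p V W \<longrightarrow> (\<forall>x\<in>fv \<psi>. v x \<in> pixels p) \<longrightarrow>
      (\<forall>x\<in>fv \<psi>. \<forall>y\<in>fv \<psi>. pos (v y) - pos (v x) \<in> box n) \<longrightarrow> n + depth \<psi> \<le> r \<longrightarrow>
      sat p v V \<psi> = sat p v W \<psi>'" by auto
  from Disj obtain \<chi>' where \<chi>': "isFO \<chi>'" "wf b \<chi>'" "fv \<chi>' \<subseteq> fv \<chi>" "fsv \<chi>' \<subseteq> codes r (fsv \<chi>)"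
    "\<forall>p v V W n. coded r p V W \<longrightarrow> (\<forall>x\<in>fv \<chi>. v x \<in> pixels p) \<longrightarrow>
      (\<forall>x\<in>fv \<chi>. \<forall>y\<in>fv \<chi>. pos (v y) - pos (v x) \<in> box n) \<longrightarrow> n + depth \<chi> \<le> r \<longrightarrow>
      sat p v V \<chi> = sat p v W \<chi>'" by auto
  have "codes r (fsv \<psi>) \<subseteq> codes r (fsv \<psi> \<union> fsv \<chi>)" "codes r (fsv \<chi>) \<subseteq> codes r (fsv \<psi> \<union> fsv \<chi>)"
    by (simp_all add: codes_mono)
  with \<psi>'(1-4) \<chi>'(1-4) have "isFO (Disj \<psi>' \<chi>') \<and> wf b (Disj \<psi>' \<chi>') \<and> fv (Disj \<psi>' \<chi>') \<subseteq> fv (Disj \<psi> \<chi>) \<and>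
      fsv (Disj \<psi>' \<chi>') \<subseteq> codes r (fsv (Disj \<psi> \<chi>))"
    by (auto simp: isFO_def)
  moreover have "sat p v V (Disj \<psi> \<chi>) = sat p v W (Disj \<psi>' \<chi>')"
    if "coded r p V W" "\<forall>x\<in>fv (Disj \<psi> \<chi>). v x \<in> pixels p"
      "\<forall>x\<in>fv (Disj \<psi> \<chi>). \<forall>y\<in>fv (Disj \<psi> \<chi>). pos (v y) - pos (v x) \<in> box n" "n + depth (Disj \<psi> \<chi>) \<le> r"
    for p v V W n
  proof -
    have "sat p v V \<psi> = sat p v W \<psi>'"
      using that by (intro \<psi>'(5)[rule_format, of p V W v n]) auto
    moreover have "sat p v V \<chi> = sat p v W \<chi>'"
      using that by (intro \<chi>'(5)[rule_format, of p V W v n]) auto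
    ultimately show ?thesis by simp
  qed
  ultimately show ?case by blast
next
  case (BEx y x \<psi>)
  then obtain \<psi>' where \<psi>': "isFO \<psi>'" "wf b \<psi>'" "fv \<psi>' \<subseteq> fv \<psi>" "fsv \<psi>' \<subseteq> codes r (fsv \<psi>)"
    "\<forall>p v V W n. coded r p V W \<longrightarrow> (\<forall>x\<in>fv \<psi>. v x \<in> pixels p) \<longrightarrow>
      (\<forall>x\<in>fv \<psi>. \<forall>y\<in>fv \<psi>. pos (v y) - pos (v x) \<in> box n) \<longrightarrow> n + depth \<psi> \<le> r \<longrightarrow>
      sat p v V \<psi> = sat p v W \<psi>'" by auto
  have "isFO (BEx y x \<psi>') \<and> wf b (BEx y x \<psi>') \<and> fv (BEx y x \<psi>') \<subseteq> fv (BEx y x \<psi>) \<and>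
      fsv (BEx y x \<psi>') \<subseteq> codes r (fsv (BEx y x \<psi>))"
    using \<psi>'(1-4) BEx.prems by (auto simp: isFO_def)
  moreover have "sat p v V (BEx y x \<psi>) = sat p v W (BEx y x \<psi>')"
    if cod: "coded r p V W" and pix: "\<forall>z\<in>fv (BEx y x \<psi>). v z \<in> pixels p"
      and off: "\<forall>z\<in>fv (BEx y x \<psi>). \<forall>w\<in>fv (BEx y x \<psi>). pos (v w) - pos (v z) \<in> box n"
      and n: "n + depth (BEx y x \<psi>) \<le> r"
    for p v V W n
  proof -
    have "sat p (v(y := a)) V \<psi> = sat p (v(y := a)) W \<psi>'" if a: "a \<in> pixels p" "adjacent p a (v x)" for a
    proof (intro \<psi>'(5)[rule_format, of p V W _ "Suc n"])
      show "(v(y := a)) z \<in> pixels p" if "z \<in> fv \<psi>" for z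
        using that pix a by auto
      from adjacent_iff_pos[OF a(1)] pix a(2) obtain e where e: "e \<in> unit_offsets" "pos a = pos (v x) + e"
        by auto
      have e1: "e \<in> box 1" using unit_offset_in_box[OF e(1), of 0] by simp
      have near: "pos (v w) - pos a \<in> box (Suc n)" "pos a - pos (v w) \<in> box (Suc n)"
        if "w \<in> fv \<psi>" "w \<noteq> y" for w
      proof -
        have "pos (v w) - pos (v x) \<in> box n" using off that by auto
        from box_diff[OF this e1] have *: "pos (v w) - pos a \<in> box (Suc n)"
          by (simp add: e(2) algebra_simps)
        then show "pos (v w) - pos a \<in> box (Suc n)" .
        from * box_uminus_iff[of "pos (v w) - pos a"] show "pos a - pos (v w) \<in> box (Suc n)" by simp
      qed
      show "pos ((v(y := a)) w) - pos ((v(y := a)) z) \<in> box (Suc n)" if "z \<in> fv \<psi>" "w \<in> fv \<psi>" for z w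
      proof (cases "z = y \<or> w = y")
        case True
        then show ?thesis using near that by auto
      next
        case False
        then have "pos (v w) - pos (v z) \<in> box n" using off that by auto
        then have "pos (v w) - pos (v z) \<in> box (Suc n)" by (rule box_mono) simp
        with False show ?thesis by simp
      qed
    qed (use cod n in auto)
    then show ?thesis by auto
  qed
  ultimately show ?case by blast
qed simp_all

lemma hier_block:
  assumes "hier base mon (\<not> ex) l \<psi>" "mon \<Longrightarrow> \<forall>q\<in>set qs. snd q = 1"
  shows "hier base mon ex (Suc l) (block ex qs \<psi>)"
  using assms unfolding hier_Suc_iff by blast

lemma PIC_nonempty: "p \<in> PIC b \<Longrightarrow> pixels p \<noteq> {}"
  by (fastforce simp: PIC_def pixels_def)

text \<open>One radius \<open>r\<close> serves all levels, so every block is recoded in the same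
  way. \<open>coded_forth\<close> and \<open>coded_back\<close> match the choices on both sides,
  which handles existential and universal blocks alike.\<close>

lemma LFO_hier_to_monadic_FO:
  assumes "hier isLFO False ex l \<phi>" "wf b \<phi>" "fv \<phi> = {}" "depth \<phi> \<le> r"
  shows "\<exists>\<phi>'. hier isFO True ex l \<phi>' \<and> wf b \<phi>' \<and> fv \<phi>' = {} \<and> fsv \<phi>' \<subseteq> codes r (fsv \<phi>) \<and>
    (\<forall>p\<in>PIC b. \<forall>v V W. coded r p V W \<longrightarrow> sat p v V \<phi> = sat p v W \<phi>')"
  using assms
proof (induction l arbitrary: ex \<phi>)
  case 0
  then obtain x \<psi> where \<phi>: "\<phi> = All1 x \<psi>" "isBF \<psi>" by (auto simp: isLFO_def)
  with 0 have "wf b \<psi>" "fv \<psi> \<subseteq> {x}" "depth \<psi> \<le> r" by (auto simp: All1_def)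
  from BF_to_FO[OF \<phi>(2) this(1), of r] obtain \<psi>' where
    \<psi>': "isFO \<psi>'" "wf b \<psi>'" "fv \<psi>' \<subseteq> fv \<psi>" "fsv \<psi>' \<subseteq> codes r (fsv \<psi>)"
    and sat: "\<forall>p v V W n. coded r p V W \<longrightarrow> (\<forall>x\<in>fv \<psi>. v x \<in> pixels p) \<longrightarrow>
      (\<forall>x\<in>fv \<psi>. \<forall>y\<in>fv \<psi>. pos (v y) - pos (v x) \<in> box n) \<longrightarrow> n + depth \<psi> \<le> r \<longrightarrow>
      sat p v V \<psi> = sat p v W \<psi>'" by blast
  have "sat p (v(x := a)) V \<psi> = sat p (v(x := a)) W \<psi>'" if "coded r p V W" "a \<in> pixels p" for p v V W a
    \<comment> \<open>The matrix has at most the free variable \<open>x\<close>, hence spread 0, and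
      the depth alone must fit into \<open>r\<close>.\<close>
    by (rule sat[rule_format, of p V W _ 0]) (use that \<open>fv \<psi> \<subseteq> {x}\<close> \<open>depth \<psi> \<le> r\<close> in auto)
  moreover have "isFO (All1 x \<psi>')" using \<psi>'(1) by (simp add: isFO_def All1_def)
  ultimately show ?case
    using \<psi>' \<open>fv \<psi> \<subseteq> {x}\<close> by (intro exI[of _ "All1 x \<psi>'"]) (auto simp: \<phi>(1))
next
  case (Suc l)
  then obtain qs \<psi> where \<phi>: "\<phi> = block ex qs \<psi>" and \<psi>: "hier isLFO False (\<not> ex) l \<psi>"
    unfolding hier_Suc_iff by blast
  with Suc.prems have "wf b \<psi>" "fv \<psi> = {}" "depth \<psi> \<le> r" by simp_all
  from Suc.IH[OF \<psi> this] obtain \<psi>' where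
    \<psi>': "hier isFO True (\<not> ex) l \<psi>'" "wf b \<psi>'" "fv \<psi>' = {}" "fsv \<psi>' \<subseteq> codes r (fsv \<psi>)"
    and sat: "\<And>p v V W. p \<in> PIC b \<Longrightarrow> coded r p V W \<Longrightarrow> sat p v V \<psi> = sat p v W \<psi>'" by blast
  obtain cs where cs: "set cs = codes r (set qs)"
    using finite_list[OF finite_codes[of "set qs" r]] by auto
  have "hier isFO True ex (Suc l) (block ex cs \<psi>')"
    using \<psi>'(1) cs by (intro hier_block) (auto simp: codes_def)
  moreover have "fsv (block ex cs \<psi>') \<subseteq> codes r (fsv \<phi>)"
    using \<psi>'(4) by (auto simp: \<phi> cs codes_def)
  moreover have "sat p v V \<phi> = sat p v W (block ex cs \<psi>')" if "p \<in> PIC b" "coded r p V W" for p v V W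
    unfolding \<phi> sat_block cs
    using coded_forth[OF that(2) _ PIC_nonempty[OF that(1)]] coded_back[OF that(2)] sat[OF that(1)]
    by (auto; metis)
  ultimately show ?case
    using \<psi>' by (intro exI[of _ "block ex cs \<psi>'"]) auto
qed

section \<open>The two hierarchies\<close>

text \<open>The parity condition says that the innermost block is existential; it alone absorbs the
  counters, while the outer blocks are copied.\<close>

lemma monadic_FO_hier_to_LFO:
  assumes "hier isFO True ex (Suc l) \<phi>" "ex \<longleftrightarrow> even l" "wf b \<phi>" "fv \<phi> = {}" "fsv \<phi> \<subseteq> UNIV \<times> {1}"
  shows "\<exists>\<phi>'. hier isLFO False ex (Suc l) \<phi>' \<and> wf b \<phi>' \<and> fv \<phi>' = {} \<and> fsv \<phi>' \<subseteq> fsv \<phi> \<and>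
    (\<forall>p\<in>PIC b. \<forall>v V. sat p v V \<phi> = sat p v V \<phi>')"
  using assms
proof (induction l arbitrary: ex \<phi>)
  case 0
  from 0(2) have ex: "ex = True" by simp
  obtain qs \<psi> where \<phi>: "\<phi> = block True qs \<psi>" and "isFO \<psi>" "\<forall>q\<in>set qs. snd q = 1"
    using 0(1) unfolding ex hier_Suc_iff hier.simps(1) by blast
  have "set qs \<subseteq> UNIV \<times> {1}"
    using \<open>\<forall>q\<in>set qs. snd q = 1\<close> by auto
  with 0(5) have "fsv \<psi> \<subseteq> UNIV \<times> {1}"
    unfolding \<phi> block_simps by blast
  moreover have "wf b \<psi>" "fv \<psi> = {}"
    using 0(3,4) unfolding \<phi> block_simps by blast+
  ultimately have \<psi>: "fsv \<psi> \<subseteq> UNIV \<times> {1}" "wf b \<psi>" "fv \<psi> = {}" by blast+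
  obtain qs' \<chi> where
    \<chi>: "isLFO \<chi>" "wf b \<chi>" "fv \<chi> = {}" "fsv \<chi> - set qs' \<subseteq> fsv \<psi>"
    and sat: "\<And>p v V. p \<in> PIC b \<Longrightarrow> sat p v V \<psi> \<longleftrightarrow> sat p v V (block True qs' \<chi>)"
    by (rule FO_to_existential_LFO[OF \<open>isFO \<psi>\<close> \<psi>(2,1,3)]) blast
  \<comment> \<open>The counters join the existing existential block, so no level is added.\<close>
  let ?\<phi>' = "block True (qs @ qs') \<chi>"
  have "hier isLFO False True (Suc 0) ?\<phi>'"
    by (rule hier_block) (simp_all add: \<chi>(1))
  moreover have "fsv ?\<phi>' \<subseteq> fsv \<phi>"
    using \<chi>(4) unfolding \<phi> block_simps by auto
  moreover have "sat p v V \<phi> = sat p v V ?\<phi>'" if "p \<in> PIC b" for p v V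
  proof -
    show ?thesis
      unfolding \<phi> block_append sat_block[of _ _ _ True qs] by (simp only: sat[OF that])
  qed
  moreover have "wf b ?\<phi>'" "fv ?\<phi>' = {}"
    unfolding block_simps by (fact \<chi>)+
  ultimately show ?case unfolding ex by blast
next
  case (Suc l)
  from Suc.prems(1) obtain qs \<psi> where \<phi>: "\<phi> = block ex qs \<psi>"
    and \<psi>: "hier isFO True (\<not> ex) (Suc l) \<psi>" and "\<forall>q\<in>set qs. snd q = 1"
    unfolding hier_Suc_iff[of _ _ _ "Suc l"] by blast
  then have "set qs \<subseteq> UNIV \<times> {1}" by auto
  with Suc.prems(5) have "fsv \<psi> \<subseteq> UNIV \<times> {1}"
    unfolding \<phi> block_simps by blast
  moreover have "wf b \<psi>" "fv \<psi> = {}"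
    using Suc.prems(3,4) unfolding \<phi> block_simps by blast+
  moreover have "\<not> ex \<longleftrightarrow> even l"
    using Suc.prems(2) by simp
  ultimately have "\<not> ex \<longleftrightarrow> even l" "wf b \<psi>" "fv \<psi> = {}" "fsv \<psi> \<subseteq> UNIV \<times> {1}" by blast+
  from Suc.IH[OF \<psi> this] obtain \<psi>' where
    \<psi>': "hier isLFO False (\<not> ex) (Suc l) \<psi>'" "wf b \<psi>'" "fv \<psi>' = {}" "fsv \<psi>' \<subseteq> fsv \<psi>"
    and sat: "\<And>p v V. p \<in> PIC b \<Longrightarrow> sat p v V \<psi> = sat p v V \<psi>'" by blast
  have "hier isLFO False ex (Suc (Suc l)) (block ex qs \<psi>')"
    using \<psi>'(1) by (rule hier_block) simp
  moreover have "sat p v V \<phi> = sat p v V (block ex qs \<psi>')" if "p \<in> PIC b" for p v V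
    unfolding \<phi> sat_block by (simp only: sat[OF that])
  moreover have "fsv (block ex qs \<psi>') \<subseteq> fsv \<phi>"
    using \<psi>'(4) unfolding \<phi> block_simps by auto
  moreover have "wf b (block ex qs \<psi>')" "fv (block ex qs \<psi>') = {}"
    unfolding block_simps by (fact \<psi>')+
  ultimately show ?case by blast
qed

lemma definable_LFO_eq_definable_monadic_FO:
  assumes "ex \<longleftrightarrow> even l"
  shows "definable_on_PIC (hier isLFO False ex (Suc l)) b = definable_on_PIC (hier isFO True ex (Suc l)) b"
proof
  show "definable_on_PIC (hier isLFO False ex (Suc l)) b \<subseteq> definable_on_PIC (hier isFO True ex (Suc l)) b"
  proof
    fix A assume "A \<in> definable_on_PIC (hier isLFO False ex (Suc l)) b"
    then obtain \<phi> where A: "A = {p \<in> PIC b. models p \<phi>}" and "sentence \<phi>" "wf b \<phi>"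
      and "hier isLFO False ex (Suc l) \<phi>"
      unfolding definable_on_PIC_def by blast
    then have \<phi>: "fv \<phi> = {}" "fsv \<phi> = {}" by (simp_all add: sentence_def)
    from LFO_hier_to_monadic_FO[OF \<open>hier isLFO False ex (Suc l) \<phi>\<close> \<open>wf b \<phi>\<close> \<phi>(1) order_refl]
    obtain \<phi>' where \<phi>': "hier isFO True ex (Suc l) \<phi>'" "wf b \<phi>'" "fv \<phi>' = {}"
      "fsv \<phi>' \<subseteq> codes (depth \<phi>) (fsv \<phi>)"
      and sat: "\<And>p v V W. p \<in> PIC b \<Longrightarrow> coded (depth \<phi>) p V W \<Longrightarrow> sat p v V \<phi> = sat p v W \<phi>'"
      by blast
    \<comment> \<open>The starting valuation of \<open>models\<close> is empty, and empty codes
      decode to empty relations.\<close>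
    have "coded r p (\<lambda>_ _. {}) (\<lambda>_ _. {})" for r p
      by (simp add: coded_def decode_def)
    then have "models p \<phi> = models p \<phi>'" if "p \<in> PIC b" for p
      unfolding models_def using sat[OF that] by blast
    then have "A = {p \<in> PIC b. models p \<phi>'}" unfolding A by blast
    moreover have "sentence \<phi>'" using \<phi>' by (simp add: sentence_def \<phi>(2) codes_def)
    ultimately show "A \<in> definable_on_PIC (hier isFO True ex (Suc l)) b"
      unfolding definable_on_PIC_def using \<phi>' by blast
  qed
  show "definable_on_PIC (hier isFO True ex (Suc l)) b \<subseteq> definable_on_PIC (hier isLFO False ex (Suc l)) b"
  proof
    fix A assume "A \<in> definable_on_PIC (hier isFO True ex (Suc l)) b"
    then obtain \<phi> where A: "A = {p \<in> PIC b. models p \<phi>}" and "sentence \<phi>" "wf b \<phi>"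
      and "hier isFO True ex (Suc l) \<phi>"
      unfolding definable_on_PIC_def by blast
    then have \<phi>: "fv \<phi> = {}" "fsv \<phi> = {}" by (simp_all add: sentence_def)
    then have "fsv \<phi> \<subseteq> UNIV \<times> {1}" by simp
    from monadic_FO_hier_to_LFO[OF \<open>hier isFO True ex (Suc l) \<phi>\<close> assms \<open>wf b \<phi>\<close> \<phi>(1) this]
    obtain \<phi>' where \<phi>': "hier isLFO False ex (Suc l) \<phi>'" "wf b \<phi>'" "fv \<phi>' = {}" "fsv \<phi>' \<subseteq> fsv \<phi>"
      and sat: "\<And>p v V. p \<in> PIC b \<Longrightarrow> sat p v V \<phi> = sat p v V \<phi>'"
      by blast
    have "A = {p \<in> PIC b. models p \<phi>'}" unfolding A models_def using sat by blast
    moreover have "sentence \<phi>'" using \<phi>' by (simp add: sentence_def \<phi>(2))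
    ultimately show "A \<in> definable_on_PIC (hier isLFO False ex (Suc l)) b"
      unfolding definable_on_PIC_def using \<phi>' by blast
  qed
qed

theorem theorem9p11:
  fixes l b :: nat
  assumes "1 \<le> l"
  shows "(odd l \<longrightarrow> SigmaLFO l b = mSigmaFO l b) \<and> (even l \<longrightarrow> PiLFO l b = mPiFO l b)"
proof -
  from assms obtain k where "l = Suc k" by (cases l) auto
  then show ?thesis
    using definable_LFO_eq_definable_monadic_FO[of True k b] definable_LFO_eq_definable_monadic_FO[of False k b]
    by (simp add: SigmaLFO_def mSigmaFO_def PiLFO_def mPiFO_def)
qed

end
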